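(* Let $A(0),A(1),A(2)$ be the three $7\times7$ matrices given in the context. If $V$ is a $7\times 1$ vector with positive entries, then the sequence of probability vectors $$\Pi_n(\omega,V)=\frac{A(\omega_1)\cdots A(\omega_n)V}{\|A(\omega_1)\cdots A(\omega_n)V\|}$$ converges, as $n\to+\infty$, to a probability vector $\mathbf{V}(\omega)$, uniformly over $\omega=\omega_1\omega_2\cdots\in\{0,1,2\}^{\mathbb{N}}$. Moreover $$\Delta(\mathbf{V}(\omega))\ge U_1+U_3+U_5,$$ except for $\omega\in\{\bar0=00\cdots,\ \bar2=22\cdots\}$, for which $$\mathbf{V}(\bar0)=\tfrac15(U_2+U_3+U_5+U_6+U_7)\quad\text{and}\quad\mathbf{V}(\bar2)=\tfrac13(U_1+U_3+U_4).$$
   Context: $$A(0)=\begin{pmatrix}1&0&0&0&0&0&0\\0&0&1&0&0&0&0\\0&0&0&1&1&0&0\\0&0&0&0&0&0&0\\1&0&0&0&0&0&1\\0&0&0&0&1&0&0\\0&1&0&0&0&0&0\end{pmatrix},\quad A(1)=\begin{pmatrix}0&0&1&1&0&0&0\\0&0&0&0&0&1&0\\0&0&0&1&1&0&0\\1&0&0&0&0&0&0\\0&0&1&0&0&0&0\\0&0&0&0&0&0&0\\0&0&0&0&0&0&0\end{pmatrix},\quad A(2)=\begin{pmatrix}1&0&0&0&1&0&1\\0&0&0&0&0&0&0\\1&0&0&0&0&0&1\\0&0&0&1&1&0&0\\0&0&0&0&1&0&0\\0&0&0&0&0&0&0\\0&0&0&0&0&0&0\end{pmatrix}.$$ $U_1,\dots,U_7$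 are the canonical column vectors of $\mathbb{R}^7$; $\|\cdot\|$ is the sum of the moduli of the entries; a probability vector is a nonnegative column vector of norm $1$. For a column vector $W$, $\Delta(W):=\sum_{i:\,W(i)\ne0}U_i$, and inequalities between vectors are entrywise. *)

theory Defs
  imports "HOL-Analysis.Analysis"
begin

(* The index type 7 is arithmetic modulo 7, so the last index 7 is the element 0;
   vector lists entries from index 1 upwards, hence entry 7 is the last one listed. *)
lemma vector_7:
  fixes a b c d e f g :: "'a::zero"
  shows "(vector [a, b, c, d, e, f, g] :: 'a^7) $ 1 = a"
    and "(vector [a, b, c, d, e, f, g] :: 'a^7) $ 2 = b"
    and "(vector [a, b, c, d, e, f, g] :: 'a^7) $ 3 = c"
    and "(vector [a, b, c, d, e, f, g] :: 'a^7) $ 4 = d"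
    and "(vector [a, b, c, d, e, f, g] :: 'a^7) $ 5 = e"
    and "(vector [a, b, c, d, e, f, g] :: 'a^7) $ 6 = f"
    and "(vector [a, b, c, d, e, f, g] :: 'a^7) $ 7 = g"
  unfolding vector_def by simp_all

definition A0 :: "real^7^7" where
  "A0 = vector
    [vector [1, 0, 0, 0, 0, 0, 0],
     vector [0, 0, 1, 0, 0, 0, 0],
     vector [0, 0, 0, 1, 1, 0, 0],
     vector [0, 0, 0, 0, 0, 0, 0],
     vector [1, 0, 0, 0, 0, 0, 1],
     vector [0, 0, 0, 0, 1, 0, 0],
     vector [0, 1, 0, 0, 0, 0, 0]]"

definition A1 :: "real^7^7" where
  "A1 = vector
    [vector [0, 0, 1, 1, 0, 0, 0],
     vector [0, 0, 0, 0, 0, 1, 0],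
     vector [0, 0, 0, 1, 1, 0, 0],
     vector [1, 0, 0, 0, 0, 0, 0],
     vector [0, 0, 1, 0, 0, 0, 0],
     vector [0, 0, 0, 0, 0, 0, 0],
     vector [0, 0, 0, 0, 0, 0, 0]]"

definition A2 :: "real^7^7" where
  "A2 = vector
    [vector [1, 0, 0, 0, 1, 0, 1],
     vector [0, 0, 0, 0, 0, 0, 0],
     vector [1, 0, 0, 0, 0, 0, 1],
     vector [0, 0, 0, 1, 1, 0, 0],
     vector [0, 0, 0, 0, 1, 0, 0],
     vector [0, 0, 0, 0, 0, 0, 0],
     vector [0, 0, 0, 0, 0, 0, 0]]"

(* The alphabet {0,1,2} is the three-element numeral type 3. *)
definition A :: "3 \<Rightarrow> real^7^7" where
  "A a = (if a = 0 then A0 else if a = 1 then A1 else A2)"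

(* A(\<omega>_1) ... A(\<omega>_n).  Words are functions on nat starting at 0, so the letter
   \<omega>_k of the mathematical notation is \<omega> (k - 1). *)
primrec A_prod :: "(nat \<Rightarrow> 3) \<Rightarrow> nat \<Rightarrow> real^7^7" where
  "A_prod \<omega> 0 = mat 1"
| "A_prod \<omega> (Suc n) = A_prod \<omega> n ** A (\<omega> n)"

(* The library norm on real^7 is the Euclidean one. *)
definition norm1 :: "real^7 \<Rightarrow> real" where
  "norm1 W = (\<Sum>i\<in>UNIV. \<bar>W $ i\<bar>)"

definition Pi_seq :: "nat \<Rightarrow> (nat \<Rightarrow> 3) \<Rightarrow> real^7 \<Rightarrow> real^7" where
  "Pi_seq n \<omega> V = (A_prod \<omega> n *v V) /\<^sub>R norm1 (A_prod \<omega> n *v V)"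

definition probability_vector :: "real^7 \<Rightarrow> bool" where
  "probability_vector W \<longleftrightarrow> (\<forall>i. W $ i \<ge> 0) \<and> norm1 W = 1"

definition U :: "7 \<Rightarrow> real^7" where
  "U i = axis i 1"

definition \<Delta> :: "real^7 \<Rightarrow> real^7" where
  "\<Delta> W = (\<Sum>i | W $ i \<noteq> 0. U i)"

end

theory Submission
  imports Defs
begin

text \<open>
  Write \<open>x\<close> for a vector \<open>A(w) v\<close>, with \<open>w\<close> a finite word and \<open>v\<close> a vector whose entries lie between
  fixed positive bounds.  Up to normalization, the tail of a product \<open>A(\<omega>\<^sub>1) \<dots> A(\<omega>\<^sub>n) V\<close> after its
  first \<open>N\<close> factors is such a vector, so the theorem amounts to this: the images of all these vectors
  under \<open>A(\<omega>\<^sub>1) \<dots> A(\<omega>\<^sub>N)\<close> have directions that become equal as \<open>N\<close> grows, uniformly in \<open>\<omega>\<close>.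

  The set of these vectors is controlled by a polyhedral cone that all three matrices preserve
  (good_cone, A_good_cone).  As a consequence the third entry of \<open>x\<close> is always at least a fixed
  share of the norm; so is the first entry unless \<open>w\<close> begins with 0, and the fifth entry unless \<open>w\<close>
  begins with 2 (heavy_orbit).  This already gives \<open>\<Delta> \<ge> U\<^sub>1 + U\<^sub>3 + U\<^sub>5\<close> off the two constant sequences: the matrix
  of the letter 0 leaves the first entry unchanged, the matrix of the letter 2 leaves the fifth
  entry unchanged, so a finite initial run of that letter cannot destroy the entry
  (limit_vector_pos).

  For convergence there are two mechanisms.  Call a word dominated by column \<open>j\<close> if every row sum
  of its matrix is at most 8 times the entry of that row in column \<open>j\<close>.  Applied to two vectors
  whose \<open>j\<close>-th entry is at least a fixed share of the norm, such a word brings their entrywise ratios closer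
  to each other by a fixed factor (comparable_act_contract), the classical contraction of Birkhoff
  and Doeblin.  Ten short words suffice (dominated_words): every sequence
  that is not eventually 0 and not eventually 2 contains them infinitely often, each followed by a
  letter that makes the right entry large (frequently_good).  If the sequence is eventually 0 or
  eventually 2 there is no such contraction, as the powers of the matrix grow only linearly; but
  this growth has an explicit direction, reached with error of order \<open>1/n\<close> (eventually_const_rate).
  The same computation evaluates the limit at the two constant sequences.

  Both mechanisms are estimates for one \<open>\<omega>\<close> at a time.  Uniformity follows by compactness: the words
  under which the images are still far apart form a tree closed under prefixes, and an infinite such
  tree over a finite alphabet would have an infinite branch (orbit_collapses_uniformly).
\<close>

section \<open>Entries, letters and the sum norm\<close>

lemma exhaust_7:
  fixes i :: 7
  obtains "i = 1" | "i = 2" | "i = 3" | "i = 4" | "i = 5" | "i = 6" | "i = 7"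
proof (induct i)
  case (of_int z)
  then have "z = 0 \<or> z = 1 \<or> z = 2 \<or> z = 3 \<or> z = 4 \<or> z = 5 \<or> z = 6" by auto
  then show ?case using of_int by auto
qed

lemma UNIV_7: "UNIV = {1::7, 2, 3, 4, 5, 6, 7}"
  using exhaust_7 by auto

lemma sum_7: "sum f (UNIV::7 set) = f 1 + f 2 + f 3 + f 4 + f 5 + f 6 + f 7"
  unfolding UNIV_7 by (simp add: ac_simps)

lemma all_7: "(\<forall>i::7. P i) \<longleftrightarrow> P 1 \<and> P 2 \<and> P 3 \<and> P 4 \<and> P 5 \<and> P 6 \<and> P 7"
  by (metis exhaust_7)

lemma letter_cases:
  fixes a :: 3
  obtains "a = 0" | "a = 1" | "a = 2"
  using exhaust_3[of a] by auto

lemma A_mult_0: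
  "(A 0 *v x) $ 1 = x $ 1"
  "(A 0 *v x) $ 2 = x $ 3"
  "(A 0 *v x) $ 3 = x $ 4 + x $ 5"
  "(A 0 *v x) $ 4 = 0"
  "(A 0 *v x) $ 5 = x $ 1 + x $ 7"
  "(A 0 *v x) $ 6 = x $ 5"
  "(A 0 *v x) $ 7 = x $ 2"
  by (simp_all add: matrix_vector_mult_def sum_7 A_def A0_def vector_7)

lemma A_mult_1:
  "(A 1 *v x) $ 1 = x $ 3 + x $ 4"
  "(A 1 *v x) $ 2 = x $ 6"
  "(A 1 *v x) $ 3 = x $ 4 + x $ 5"
  "(A 1 *v x) $ 4 = x $ 1"
  "(A 1 *v x) $ 5 = x $ 3"
  "(A 1 *v x) $ 6 = 0"
  "(A 1 *v x) $ 7 = 0"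
  by (simp_all add: matrix_vector_mult_def sum_7 A_def A1_def vector_7)

lemma A_mult_2:
  "(A 2 *v x) $ 1 = x $ 1 + x $ 5 + x $ 7"
  "(A 2 *v x) $ 2 = 0"
  "(A 2 *v x) $ 3 = x $ 1 + x $ 7"
  "(A 2 *v x) $ 4 = x $ 4 + x $ 5"
  "(A 2 *v x) $ 5 = x $ 5"
  "(A 2 *v x) $ 6 = 0"
  "(A 2 *v x) $ 7 = 0"
  by (simp_all add: matrix_vector_mult_def sum_7 A_def A2_def vector_7)


lemma norm1_nonneg: "norm1 x \<ge> 0"
  by (simp add: norm1_def sum_nonneg)

lemma norm1_scaleR: "norm1 (c *\<^sub>R x) = \<bar>c\<bar> * norm1 x"
  by (simp add: norm1_def abs_mult sum_distrib_left)

lemma norm1_triangle: "norm1 (x + y) \<le> norm1 x + norm1 y"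
  by (simp add: norm1_def sum.distrib [symmetric] sum_mono)

lemma norm1_eq_sum: "0 \<le> x \<Longrightarrow> norm1 x = (\<Sum>i\<in>UNIV. x $ i)"
  by (simp add: norm1_def less_eq_vec_def)

lemma norm1_7: "norm1 x = \<bar>x$1\<bar> + \<bar>x$2\<bar> + \<bar>x$3\<bar> + \<bar>x$4\<bar> + \<bar>x$5\<bar> + \<bar>x$6\<bar> + \<bar>x$7\<bar>"
  by (simp add: norm1_def sum_7)

lemma component_le_norm1: "\<bar>x $ i\<bar> \<le> norm1 x"
  unfolding norm1_def by (rule member_le_sum) auto

lemma norm1_mono: "0 \<le> x \<Longrightarrow> x \<le> y \<Longrightarrow> norm1 x \<le> norm1 y"
  unfolding norm1_def less_eq_vec_def by (intro sum_mono) (force simp: abs_le_iff intro: order_trans)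

lemma A_nonneg: "A a $ i $ j \<ge> 0"
  by (cases a rule: letter_cases; cases i rule: exhaust_7; cases j rule: exhaust_7)
     (simp_all add: A_def A0_def A1_def A2_def vector_7)

lemma A_column_sum_le: "(\<Sum>i\<in>UNIV. A a $ i $ j) \<le> 3"
  by (cases a rule: letter_cases; cases j rule: exhaust_7)
     (simp_all add: sum_7 A_def A0_def A1_def A2_def vector_7)

lemma norm1_A_le: "norm1 (A a *v x) \<le> 3 * norm1 x"
proof -
  have "norm1 (A a *v x) \<le> (\<Sum>i\<in>UNIV. \<Sum>j\<in>UNIV. A a $ i $ j * \<bar>x $ j\<bar>)"
    unfolding norm1_def matrix_vector_mult_def
    by (intro sum_mono) (simp add: order_trans[OF sum_abs] abs_mult A_nonneg)
  also have "\<dots> = (\<Sum>j\<in>UNIV. (\<Sum>i\<in>UNIV. A a $ i $ j) * \<bar>x $ j\<bar>)"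
    unfolding sum_distrib_right by (rule sum.swap)
  also have "\<dots> \<le> (\<Sum>j\<in>UNIV. 3 * \<bar>x $ j\<bar>)"
    by (intro sum_mono mult_right_mono A_column_sum_le) auto
  finally show ?thesis by (simp add: norm1_def sum_distrib_left)
qed

section \<open>Words acting on vectors\<close>

text \<open>
  Words are lists so that a letter put in front of a word is a \<open>Cons\<close>: products are analysed from the
  right, and every induction extends a word on its left.
\<close>

definition act :: "3 list \<Rightarrow> real^7 \<Rightarrow> real^7" where
  "act w x = foldr (\<lambda>a. (*v) (A a)) w x"

lemma act_Nil [simp]: "act [] x = x"
  and act_Cons [simp]: "act (a # w) x = A a *v act w x"
  and act_append [simp]: "act (u @ w) x = act u (act w x)"
  by (simp_all add: act_def)

lemma act_diff: "act w (x - y) = act w x - act w y"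
  by (induction w) (simp_all add: matrix_vector_mult_diff_distrib)

lemma act_scaleR: "act w (c *\<^sub>R x) = c *\<^sub>R act w x"
  by (induction w) (simp_all add: matrix_vector_mult_scaleR)

lemma act_nonneg: "0 \<le> x \<Longrightarrow> 0 \<le> act w x"
  by (induction w)
     (auto simp: less_eq_vec_def matrix_vector_mult_def intro!: sum_nonneg mult_nonneg_nonneg A_nonneg)

lemma act_mono: "x \<le> y \<Longrightarrow> act w x \<le> act w y"
  using act_nonneg[of "y - x" w] by (simp add: act_diff)

lemma norm1_act_le: "norm1 (act w x) \<le> 3 ^ length w * norm1 x"
proof (induction w)
  case (Cons a w)
  have "norm1 (act (a # w) x) \<le> 3 * norm1 (act w x)" by (simp add: norm1_A_le)
  with Cons show ?case by simp
qed simp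

definition seg :: "(nat \<Rightarrow> 3) \<Rightarrow> nat \<Rightarrow> nat \<Rightarrow> 3 list" where
  "seg \<omega> p q = map \<omega> [p..<q]"

lemma seg_append: "p \<le> q \<Longrightarrow> q \<le> r \<Longrightarrow> seg \<omega> p r = seg \<omega> p q @ seg \<omega> q r"
  unfolding seg_def by (metis map_append upt_add_eq_append le_add_diff_inverse)

lemma seg_Cons: "p < q \<Longrightarrow> seg \<omega> p q = \<omega> p # seg \<omega> (Suc p) q"
  by (simp add: seg_def upt_conv_Cons)

lemma seg_Suc: "p \<le> q \<Longrightarrow> seg \<omega> p (Suc q) = seg \<omega> p q @ [\<omega> q]"
  by (simp add: seg_def)

lemma A_prod_eq_act: "A_prod \<omega> n *v x = act (seg \<omega> 0 n) x"
proof (induction n arbitrary: x)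
  case (Suc n)
  have "A_prod \<omega> (Suc n) *v x = A_prod \<omega> n *v (A (\<omega> n) *v x)"
    by (simp add: matrix_vector_mul_assoc)
  then show ?case by (simp add: Suc seg_Suc)
qed (simp add: seg_def)

definition normalize1 :: "real^7 \<Rightarrow> real^7" where
  "normalize1 x = x /\<^sub>R norm1 x"

lemma Pi_seq_eq: "Pi_seq n \<omega> V = normalize1 (act (seg \<omega> 0 n) V)"
  by (simp add: Pi_seq_def normalize1_def A_prod_eq_act)

lemma normalize1_scaleR: "c > 0 \<Longrightarrow> normalize1 (c *\<^sub>R x) = normalize1 x"
  by (simp add: normalize1_def norm1_scaleR)

lemma norm1_normalize1: "norm1 x \<noteq> 0 \<Longrightarrow> norm1 (normalize1 x) = 1"
  using norm1_nonneg[of x] by (simp add: normalize1_def norm1_scaleR)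

text \<open>
  Only one of the two norms appears in the bound, so a vector can be compared with an approximation
  whose norm is known.
\<close>

lemma norm1_diff_normalize1:
  assumes "norm1 x > 0" "norm1 y > 0"
  shows "norm1 (normalize1 x - normalize1 y) \<le> 2 * norm1 (x - y) / norm1 y"
proof -
  define s t where "s = norm1 x" and "t = norm1 y"
  have "s > 0" "t > 0" using assms by (simp_all add: s_def t_def)
  have tri: "\<bar>t - s\<bar> \<le> norm1 (x - y)"
    using norm1_triangle[of "x - y" y] norm1_triangle[of "y - x" x] norm1_scaleR[of "-1" "x - y"]
    by (simp add: s_def t_def)
  have "normalize1 x - normalize1 y = ((t - s) / t) *\<^sub>R normalize1 x + (1 / t) *\<^sub>R (x - y)"
    using \<open>s > 0\<close> \<open>t > 0\<close>
    by (simp add: normalize1_def s_def[symmetric] t_def[symmetric] vec_eq_iff field_simps)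
  then have "norm1 (normalize1 x - normalize1 y)
      \<le> norm1 (((t - s) / t) *\<^sub>R normalize1 x) + norm1 ((1 / t) *\<^sub>R (x - y))"
    using norm1_triangle by metis
  also have "\<dots> = \<bar>t - s\<bar> / t + norm1 (x - y) / t"
    using \<open>t > 0\<close> assms by (simp add: norm1_scaleR norm1_normalize1)
  also have "\<dots> \<le> norm1 (x - y) / t + norm1 (x - y) / t"
    using tri \<open>t > 0\<close> by (intro add_right_mono divide_right_mono) simp_all
  finally show ?thesis by (simp add: t_def)
qed

section \<open>An invariant cone\<close>

text \<open>
  The system is chosen to be closed: each inequality, pulled back along each of the three matrices, is
  a nonnegative combination of inequalities of the same list.  The constants are rounded from the
  extreme ratios of entries on the vectors \<open>A(w) 1\<close>, where \<open>1\<close> is the vector of ones.  The purpose of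
  the cone are the bounds in good_coneD, which by themselves are not preserved.
\<close>

definition good_cone :: "(real^7) set" where
  "good_cone = {x. 0 \<le> x \<and>
     x$1 + x$3 \<le> 5 * x$4 + 4 * x$5 \<and>
     x$1 \<le> 2 * x$4 + 2 * x$5 \<and>
     x$1 + x$7 \<le> 2 * x$4 + 3 * x$5 \<and>
     x$1 \<le> 2 * x$3 + x$4 \<and>
     x$7 \<le> 2 * x$5 \<and>
     x$4 + x$7 \<le> x$3 + 2 * x$5 \<and>
     x$6 \<le> x$3 \<and>
     x$5 \<le> 3 * x$3 \<and>
     x$2 \<le> x$1 + 2 * x$6 \<and>
     x$3 \<le> x$1 + 2 * x$5 \<and>
     x$4 \<le> x$1 + x$5 \<and>
     x$5 \<le> x$1 + 2 * x$6 \<and>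
     x$4 + x$6 \<le> x$1 + x$3 \<and>
     x$2 \<le> 2 * x$1 + 2 * x$7 \<and>
     x$3 \<le> 2 * x$1 + 2 * x$2 \<and>
     x$7 \<le> 2 * x$1 + 2 * x$2 \<and>
     x$4 + x$5 \<le> 3 * x$1 + 2 * x$7}"

lemma good_coneD:
  assumes "x \<in> good_cone"
  shows "0 \<le> x" "norm1 x \<le> 40 * x$3" "norm1 x \<le> 240 * (x$1 + x$7)"
proof -
  show nonneg: "0 \<le> x" using assms by (simp add: good_cone_def)
  have eq: "norm1 x = x$1 + x$2 + x$3 + x$4 + x$5 + x$6 + x$7"
    using norm1_eq_sum[OF nonneg] by (simp only: sum_7)
  note facts = assms[unfolded good_cone_def mem_Collect_eq less_eq_vec_def all_7 zero_index]
  have "x$4 \<le> 7 * x$3" "x$7 \<le> 6 * x$3" "x$1 \<le> 9 * x$3" "x$2 \<le> 11 * x$3"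
    using facts by (smt (z3))+
  then show norm1_le: "norm1 x \<le> 40 * x$3"
    using facts unfolding eq by (smt (z3))
  have "x$3 \<le> 6 * (x$1 + x$7)" using facts by (smt (z3))
  with norm1_le show "norm1 x \<le> 240 * (x$1 + x$7)" by linarith
qed

text \<open>
  For each letter, every inequality is a Farkas combination of the inequalities for \<open>x\<close>.
\<close>

lemma A_good_cone:
  assumes "x \<in> good_cone"
  shows "A a *v x \<in> good_cone"
proof -
  note facts = assms[unfolded good_cone_def mem_Collect_eq less_eq_vec_def all_7 zero_index]
  show ?thesis
  proof (cases a rule: letter_cases)
    case 1
    show ?thesis
      unfolding good_cone_def mem_Collect_eq less_eq_vec_def all_7 zero_index 1 A_mult_0
      using facts by (smt (z3))
  next
    case 2
    show ?thesis
      unfolding good_cone_def mem_Collect_eq less_eq_vec_def all_7 zero_index 2 A_mult_1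
      using facts by (smt (z3))
  next
    case 3
    show ?thesis
      unfolding good_cone_def mem_Collect_eq less_eq_vec_def all_7 zero_index 3 A_mult_2
      using facts by (smt (z3))
  qed
qed

lemma act_good_cone: "x \<in> good_cone \<Longrightarrow> act w x \<in> good_cone"
  by (induction w) (simp_all add: A_good_cone)

lemma ones_good_cone: "1 \<in> good_cone"
  by (simp add: good_cone_def less_eq_vec_def)

section \<open>Contraction of entrywise ratios\<close>

text \<open>
  The ratios \<open>x\<^sub>i / y\<^sub>i\<close> all lie in an interval \<open>[a, a (1 + \<eta>)]\<close>; in this form no entry of \<open>y\<close> has to be
  nonzero, and matrices with nonnegative entries preserve the relation.
\<close>

definition comparable :: "real \<Rightarrow> real^7 \<Rightarrow> real^7 \<Rightarrow> bool" where
  "comparable \<eta> y x \<longleftrightarrow> (\<exists>a>0. a *\<^sub>R y \<le> x \<and> x \<le> (a * (1 + \<eta>)) *\<^sub>R y)"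

lemma comparable_act:
  assumes "comparable \<eta> y x"
  shows "comparable \<eta> (act w y) (act w x)"
  using assms unfolding comparable_def by (metis act_mono act_scaleR)

lemma norm1_normalize1_diff_comparable:
  assumes "comparable \<eta> y x" "0 \<le> y" "norm1 y > 0" "\<eta> \<ge> 0"
  shows "norm1 (normalize1 x - normalize1 y) \<le> \<eta>"
proof -
  obtain a where a: "a > 0" "a *\<^sub>R y \<le> x" "x \<le> (a * (1 + \<eta>)) *\<^sub>R y"
    using assms(1) by (auto simp: comparable_def)
  define s t where "s = norm1 y" and "t = norm1 x"
  have nonneg_y: "0 \<le> y $ i" for i using assms(2) by (simp add: less_eq_vec_def)
  have ai: "a * y $ i \<le> x $ i" "x $ i \<le> a * (1 + \<eta>) * y $ i" for i
    using a(2,3) by (simp_all add: less_eq_vec_def)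
  have "0 \<le> a *\<^sub>R y" using a(1) nonneg_y by (simp add: less_eq_vec_def)
  then have "0 \<le> x" using a(2) by simp
  have t: "a * s \<le> t" "t \<le> a * (1 + \<eta>) * s"
    using norm1_mono[OF \<open>0 \<le> a *\<^sub>R y\<close> a(2)] norm1_mono[OF \<open>0 \<le> x\<close> a(3)] a(1) assms(4)
    by (simp_all add: norm1_scaleR s_def t_def)
  have s: "s > 0" using assms(3) by (simp add: s_def)
  have "t > 0" using t(1) a(1) s by (meson less_le_trans mult_pos_pos)
  have "\<bar>x $ i / t - y $ i / s\<bar> \<le> \<eta> * (y $ i / s)" for i
  proof -
    have u: "x $ i * s \<le> (1 + \<eta>) * y $ i * t"
    proof -
      have "x $ i * s \<le> a * (1 + \<eta>) * y $ i * s" using ai(2) s by (intro mult_right_mono) auto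
      also have "\<dots> = (1 + \<eta>) * y $ i * (a * s)" by simp
      also have "\<dots> \<le> (1 + \<eta>) * y $ i * t"
        using t(1) nonneg_y assms(4) by (intro mult_left_mono) auto
      finally show ?thesis .
    qed
    have l: "(1 - \<eta>) * y $ i * t \<le> x $ i * s"
    proof (cases "\<eta> \<le> 1")
      case True
      have "(1 - \<eta>) * y $ i * t \<le> (1 - \<eta>) * y $ i * (a * (1 + \<eta>) * s)"
        using t(2) nonneg_y True by (intro mult_left_mono) auto
      also have "\<dots> = (1 - \<eta>\<^sup>2) * (a * y $ i * s)" by (simp add: algebra_simps power2_eq_square)
      also have "\<dots> \<le> 1 * (a * y $ i * s)"
        using a(1) nonneg_y s by (intro mult_right_mono) auto
      also have "\<dots> \<le> x $ i * s" using ai(1) s by (simp add: mult_right_mono)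
      finally show ?thesis .
    next
      case False
      have "(1 - \<eta>) * y $ i * t \<le> 0"
        using False nonneg_y \<open>t > 0\<close> by (intro mult_nonpos_nonneg) auto
      also have "0 \<le> x $ i * s" using \<open>0 \<le> x\<close> s by (simp add: less_eq_vec_def)
      finally show ?thesis .
    qed
    show ?thesis using u l s \<open>t > 0\<close> by (simp add: abs_le_iff field_simps)
  qed
  then have "norm1 (normalize1 x - normalize1 y) \<le> (\<Sum>i\<in>UNIV. \<eta> * (y $ i / s))"
    unfolding norm1_def[of "_ - _"]
    by (intro sum_mono) (simp add: normalize1_def s_def t_def divide_inverse mult.commute)
  also have "\<dots> = \<eta> * ((\<Sum>i\<in>UNIV. y $ i) / s)"
    by (simp add: sum_distrib_left sum_divide_distrib)
  also have "\<dots> = \<eta>" using norm1_eq_sum[OF assms(2)] s by (simp add: s_def)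
  finally show ?thesis .
qed

text \<open>
  The left side contains the row sums of the matrix of \<open>w\<close> and the right side its column \<open>j\<close>.
  In particular column \<open>j\<close> is positive in every nonzero row.  The constant 8 covers the words used
  below, the largest ratio being 7, for the word 1111.
\<close>

definition dominated_by_column :: "7 \<Rightarrow> 3 list \<Rightarrow> bool" where
  "dominated_by_column j w \<longleftrightarrow> act w 1 \<le> 8 *\<^sub>R act w (axis j 1)"

definition heavy :: "real \<Rightarrow> 7 \<Rightarrow> real^7 \<Rightarrow> bool" where
  "heavy C j x \<longleftrightarrow> 0 \<le> x \<and> 0 < norm1 x \<and> norm1 x \<le> C * x $ j"

lemma heavy_pos:
  assumes "heavy C j x" "C > 0"
  shows "x $ j > 0"
proof -
  have "0 < C * x $ j" using assms(1) by (simp add: heavy_def)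
  then show ?thesis using assms(2) by (simp add: zero_less_mult_iff)
qed

lemma act_le_column:
  assumes "dominated_by_column j w" "heavy C j x" "C > 0"
  shows "act w x \<le> (8 * C * x $ j) *\<^sub>R act w (axis j 1)"
proof -
  have "x \<le> norm1 x *\<^sub>R 1"
    using component_le_norm1[of x] by (auto simp: less_eq_vec_def abs_le_iff)
  then have "act w x \<le> norm1 x *\<^sub>R act w 1" using act_mono[of x "norm1 x *\<^sub>R 1" w] by (simp add: act_scaleR)
  also have "\<dots> \<le> (C * x $ j) *\<^sub>R act w 1"
    using assms(2) by (intro scaleR_right_mono act_nonneg) (simp_all add: heavy_def less_eq_vec_def)
  also have "\<dots> \<le> (C * x $ j) *\<^sub>R 8 *\<^sub>R act w (axis j 1)"
    using assms heavy_pos[OF assms(2,3)]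
    by (intro scaleR_left_mono) (simp_all add: dominated_by_column_def)
  finally show ?thesis by (simp add: mult_ac)
qed

lemma column_le_act:
  assumes "0 \<le> x"
  shows "(x $ j) *\<^sub>R act w (axis j 1) \<le> act w x"
proof -
  have "(x $ j) *\<^sub>R axis j 1 \<le> x" using assms by (simp add: less_eq_vec_def axis_def)
  then show ?thesis using act_mono[of "(x $ j) *\<^sub>R axis j 1" x w] by (simp add: act_scaleR)
qed

text \<open>
  Each image lies between \<open>x\<^sub>j\<close>, respectively \<open>y\<^sub>j\<close>, times column \<open>j\<close> and \<open>8 C\<close> times that, so the ratios
  differ from \<open>x\<^sub>j / y\<^sub>j\<close> by a factor of at most \<open>8 C\<close> in either direction.  This provides a first finite
  \<open>\<eta>\<close>, which the vectors themselves need not have: one may have zero entries where the other has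
  none.
\<close>

lemma comparable_act_heavy:
  assumes "dominated_by_column j w" "heavy C j x" "heavy C j y" "C > 0"
  shows "comparable ((8 * C)\<^sup>2 - 1) (act w y) (act w x)"
proof -
  define r where "r = x $ j / y $ j"
  have pos: "x $ j > 0" "y $ j > 0" using assms heavy_pos by blast+
  then have "r > 0" by (simp add: r_def)
  let ?e = "act w (axis j 1)"
  have "(r / (8 * C)) *\<^sub>R act w y \<le> (r / (8 * C)) *\<^sub>R (8 * C * y $ j) *\<^sub>R ?e"
    using act_le_column[OF assms(1,3,4)] \<open>r > 0\<close> assms(4) by (intro scaleR_left_mono) auto
  also have "\<dots> = x $ j *\<^sub>R ?e" using pos assms(4) by (simp add: r_def)
  also have "\<dots> \<le> act w x" using assms(2) by (intro column_le_act) (simp add: heavy_def)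
  finally have lower: "(r / (8 * C)) *\<^sub>R act w y \<le> act w x" .
  have "act w x \<le> (8 * C * x $ j) *\<^sub>R ?e" by (rule act_le_column[OF assms(1,2,4)])
  also have "\<dots> = (8 * C * r) *\<^sub>R y $ j *\<^sub>R ?e" using pos by (simp add: r_def)
  also have "\<dots> \<le> (8 * C * r) *\<^sub>R act w y"
    using assms(3,4) \<open>r > 0\<close> by (intro scaleR_left_mono column_le_act) (auto simp: heavy_def)
  finally have upper: "act w x \<le> (8 * C * r) *\<^sub>R act w y" .
  have "r / (8 * C) * (1 + ((8 * C)\<^sup>2 - 1)) = 8 * C * r"
    using assms(4) by (simp add: power2_eq_square)
  then show ?thesis unfolding comparable_def
    using lower upper \<open>r > 0\<close> assms(4) by (intro exI[of _ "r / (8 * C)"]) simp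
qed

text \<open>
  Let \<open>t = x\<^sub>j / y\<^sub>j\<close>, a point of the interval \<open>[a, b]\<close> of ratios.  The nonnegative vectors \<open>x - a y\<close> and
  \<open>b y - x\<close> have \<open>j\<close>-th entries \<open>(t - a) y\<^sub>j\<close> and \<open>(b - t) y\<^sub>j\<close>.  Column \<open>j\<close> transmits a share \<open>\<delta>\<close> of these to
  every row, so the interval loses length \<open>\<delta> (t - a)\<close> at its lower end and \<open>\<delta> (b - t)\<close> at its upper end,
  which is \<open>\<delta> (b - a)\<close> in all, wherever \<open>t\<close> lies.
\<close>

lemma comparable_act_contract:
  assumes "dominated_by_column j w" "heavy C j y" "C > 0" "8 * C \<ge> 1" "comparable \<eta> y x" "\<eta> \<ge> 0"
  shows "comparable ((1 - 1 / (8 * C)) * \<eta>) (act w y) (act w x)"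
proof -
  obtain a where a: "a > 0" "a *\<^sub>R y \<le> x" "x \<le> (a * (1 + \<eta>)) *\<^sub>R y"
    using assms(5) by (auto simp: comparable_def)
  define \<delta> b t where "\<delta> = 1 / (8 * C)" and "b = a * (1 + \<eta>)" and "t = x $ j / y $ j"
  have pos: "y $ j > 0" using assms(2,3) heavy_pos by blast
  have tj: "x $ j = t * y $ j" using pos by (simp add: t_def)
  have "a * y $ j \<le> x $ j" "x $ j \<le> b * y $ j" using a(2,3) by (simp_all add: less_eq_vec_def b_def)
  then have t: "a \<le> t" "t \<le> b" using pos by (simp_all add: tj)
  have \<delta>: "\<delta> > 0" "\<delta> \<le> 1" using assms(3,4) by (simp_all add: \<delta>_def)
  let ?e = "act w (axis j 1)"
  have ey: "\<delta> *\<^sub>R act w y \<le> y $ j *\<^sub>R ?e"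
    using scaleR_left_mono[OF act_le_column[OF assms(1-3)], of \<delta>] \<delta>(1) assms(3)
    by (simp add: \<delta>_def)
  \<comment> \<open>\<open>z\<close> will be \<open>x - a y\<close> and then \<open>b y - x\<close>\<close>
  have gain: "(s * \<delta>) *\<^sub>R act w y \<le> act w z" if "0 \<le> z" "z $ j = s * y $ j" "s \<ge> 0" for s z
  proof -
    have "(s * \<delta>) *\<^sub>R act w y \<le> s *\<^sub>R y $ j *\<^sub>R ?e"
      using scaleR_left_mono[OF ey that(3)] by simp
    also have "\<dots> \<le> act w z" using column_le_act[OF that(1), of j w] by (simp add: that(2))
    finally show ?thesis .
  qed
  have "((t - a) * \<delta>) *\<^sub>R act w y \<le> act w (x - a *\<^sub>R y)"
    using a(2) t by (intro gain) (simp_all add: tj left_diff_distrib)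
  then have lower: "(a + (t - a) * \<delta>) *\<^sub>R act w y \<le> act w x"
    by (simp add: act_diff act_scaleR scaleR_left_distrib algebra_simps)
  have "((b - t) * \<delta>) *\<^sub>R act w y \<le> act w (b *\<^sub>R y - x)"
    using a(3) t by (intro gain) (simp_all add: tj b_def left_diff_distrib)
  then have "act w x \<le> b *\<^sub>R act w y - ((b - t) * \<delta>) *\<^sub>R act w y"
    by (simp add: act_diff act_scaleR algebra_simps)
  also have "\<dots> = (b - (b - t) * \<delta>) *\<^sub>R act w y" by (simp add: scaleR_left_diff_distrib)
  finally have upper: "act w x \<le> (b - (b - t) * \<delta>) *\<^sub>R act w y" .
  define a' where "a' = a + (t - a) * \<delta>"
  have "a' \<ge> a" using t \<delta> by (simp add: a'_def)
  \<comment> \<open>raising the lower end of the interval only helps, since \<open>\<eta>\<close> is relative to it\<close>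
  have "b - (b - t) * \<delta> = a' + (1 - \<delta>) * \<eta> * a"
    by (simp add: a'_def b_def algebra_simps)
  also have "\<dots> \<le> a' + (1 - \<delta>) * \<eta> * a'"
    using \<open>a' \<ge> a\<close> \<delta> assms(6) by (intro add_left_mono mult_left_mono) auto
  also have "\<dots> = a' * (1 + (1 - \<delta>) * \<eta>)" by (simp add: algebra_simps)
  finally have "(b - (b - t) * \<delta>) *\<^sub>R act w y \<le> (a' * (1 + (1 - \<delta>) * \<eta>)) *\<^sub>R act w y"
    using assms(2) by (intro scaleR_right_mono act_nonneg) (simp_all add: heavy_def)
  then show ?thesis unfolding comparable_def \<delta>_def[symmetric]
    using lower upper \<open>a' \<ge> a\<close> a(1) by (intro exI[of _ a']) (auto simp: a'_def)
qed

text \<open>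
  The column depends on the last letter of the word only: column 1 after 0, column 3 after 1 and
  column 5 after 2.
\<close>

lemma dominated_words:
  "dominated_by_column 1 [2, 0]"
  "dominated_by_column 1 [2, 0, 0]"
  "dominated_by_column 1 [2, 0, 0, 0]"
  "dominated_by_column 1 [0, 0, 0, 0]"
  "dominated_by_column 1 [1, 0, 0]"
  "dominated_by_column 1 [1, 0, 0, 0]"
  "dominated_by_column 3 [2, 1]"
  "dominated_by_column 3 [1, 0, 1]"
  "dominated_by_column 3 [1, 1, 1, 1]"
  "dominated_by_column 5 [2, 2]"
  by (simp_all add: dominated_by_column_def less_eq_vec_def all_7 A_mult_0 A_mult_1 A_mult_2 axis_def)

section \<open>Which entries are large\<close>

lemma norm1_A_pos:
  assumes "x \<in> good_cone" "norm1 x > 0"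
  shows "norm1 (A a *v x) > 0"
proof -
  note c = good_coneD[OF assms(1)]
  have "x$3 > 0" "x$1 + x$7 > 0" "x$5 \<ge> 0" "x$1 \<ge> 0" "x$7 \<ge> 0" "x$4 \<ge> 0"
    using c assms(2) by (auto simp: less_eq_vec_def)
  then have "\<exists>i. (A a *v x) $ i \<noteq> 0"
    by (cases a rule: letter_cases)
       (force simp: A_mult_0(2) intro: exI[of _ 2], force simp: A_mult_1(5) intro: exI[of _ 5],
        force simp: A_mult_2(1) intro: exI[of _ 1])
  then show ?thesis
    by (metis component_le_norm1 abs_le_zero_iff less_eq_real_def norm1_nonneg)
qed

lemma norm1_act_pos: "x \<in> good_cone \<Longrightarrow> norm1 x > 0 \<Longrightarrow> norm1 (act w x) > 0"
  by (induction w) (simp_all add: norm1_A_pos act_good_cone)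

text \<open>
  A letter other than 0 makes the new first entry at least \<open>x\<^sub>3\<close> or \<open>x\<^sub>1 + x\<^sub>7\<close>, and a letter other than 2 does
  the same for the new fifth entry.  Both are at least \<open>1/240\<close> of the norm of \<open>x\<close>, and a letter multiplies the
  norm by at most 3.
\<close>

lemma heavy_cone:
  assumes x: "x \<in> good_cone" "norm1 x > 0"
  shows "heavy 720 3 x"
    and "a \<noteq> 0 \<Longrightarrow> heavy 720 1 (A a *v x)"
    and "a \<noteq> 2 \<Longrightarrow> heavy 720 5 (A a *v x)"
proof -
  note c = good_coneD[OF x(1)]
  have nonneg: "x$i \<ge> 0" for i using c(1) by (simp add: less_eq_vec_def)
  have nonneg': "0 \<le> A a *v x" using good_coneD(1)[OF A_good_cone[OF x(1)]] .
  show "heavy 720 3 x" using c x(2) nonneg[of 3] by (simp add: heavy_def)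
  show "heavy 720 1 (A a *v x)" if "a \<noteq> 0"
    using that nonneg' norm1_A_pos[OF x, of a] norm1_A_le[of a x] c nonneg[of 4] nonneg[of 5] nonneg[of 3]
    by (cases a rule: letter_cases) (simp_all add: heavy_def A_mult_1(1) A_mult_2(1))
  show "heavy 720 5 (A a *v x)" if "a \<noteq> 2"
    using that nonneg' norm1_A_pos[OF x, of a] norm1_A_le[of a x] c nonneg[of 3]
    by (cases a rule: letter_cases) (simp_all add: heavy_def A_mult_0(5) A_mult_1(5))
qed

text \<open>
  The bounds on \<open>v\<close> exclude vectors such as \<open>U 5\<close>, whose direction is periodic under the powers of the
  matrix of 0.  Every positive vector belongs to \<open>orbit \<kappa>\<close> for some \<open>\<kappa>\<close>, and the set is closed under
  all three matrices, which a plain bound on the entries is not.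
\<close>

definition orbit :: "real \<Rightarrow> (real^7) set" where
  "orbit \<kappa> = {act w v | w v. \<forall>i. 1 / \<kappa> \<le> v $ i \<and> v $ i \<le> \<kappa>}"

lemma act_orbit:
  assumes "x \<in> orbit \<kappa>"
  shows "act u x \<in> orbit \<kappa>"
proof -
  obtain w v where "x = act w v" "\<forall>i. 1 / \<kappa> \<le> v $ i \<and> v $ i \<le> \<kappa>"
    using assms by (auto simp: orbit_def)
  then have "act u x = act (u @ w) v" by simp
  then show ?thesis using \<open>\<forall>i. _ i\<close> unfolding orbit_def by blast
qed

lemma A_orbit: "x \<in> orbit \<kappa> \<Longrightarrow> A a *v x \<in> orbit \<kappa>"
  using act_orbit[of x \<kappa> "[a]"] by simp

lemma norm1_one: "norm1 1 = 7"
  by (simp add: norm1_7)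

text \<open>
  The vector \<open>v\<close> lies between \<open>1 / \<kappa>\<close> times and \<open>\<kappa>\<close> times the vector of ones, and the matrices preserve this.
  Hence estimates need to be made only for the vector of ones, which lies in the cone.
\<close>

lemma heavy_act_bounded:
  assumes "\<kappa> > 0" "\<forall>i. 1 / \<kappa> \<le> v $ i \<and> v $ i \<le> \<kappa>" "heavy C j (act w 1)" "C > 0"
  shows "heavy (C * \<kappa>\<^sup>2) j (act w v)"
proof -
  have "(1 / \<kappa>) *\<^sub>R 1 \<le> v" "v \<le> \<kappa> *\<^sub>R 1" using assms(2) by (simp_all add: less_eq_vec_def)
  then have lower: "(1 / \<kappa>) *\<^sub>R act w 1 \<le> act w v" and upper: "act w v \<le> \<kappa> *\<^sub>R act w 1"
    using act_mono act_scaleR by metis+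
  have "0 \<le> (1 / \<kappa>) *\<^sub>R act w 1"
    using assms(1,3) by (simp add: heavy_def less_eq_vec_def)
  with lower have nonneg: "0 \<le> act w v" by simp
  have "0 < (1 / \<kappa>) * norm1 (act w 1)" using assms(1,3) by (simp add: heavy_def)
  also have "\<dots> \<le> norm1 (act w v)"
    using norm1_mono[OF \<open>0 \<le> (1 / \<kappa>) *\<^sub>R act w 1\<close> lower] assms(1) by (simp add: norm1_scaleR)
  finally have pos: "0 < norm1 (act w v)" .
  have "norm1 (act w v) \<le> \<kappa> * norm1 (act w 1)"
    using norm1_mono[OF nonneg upper] assms(1) by (simp add: norm1_scaleR)
  also have "\<dots> \<le> \<kappa> * (C * act w 1 $ j)" using assms(1,3) by (simp add: heavy_def)
  also have "\<dots> \<le> \<kappa> * (C * (\<kappa> * act w v $ j))"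
  proof -
    have "(1 / \<kappa>) * act w 1 $ j \<le> act w v $ j" using lower by (simp add: less_eq_vec_def)
    then have "act w 1 $ j \<le> \<kappa> * act w v $ j" using assms(1) by (simp add: field_simps)
    then show ?thesis using assms(1,4) by (intro mult_left_mono) auto
  qed
  finally show ?thesis using nonneg pos by (simp add: heavy_def power2_eq_square mult_ac)
qed

lemma heavy_orbit:
  assumes "\<kappa> > 0" "x \<in> orbit \<kappa>"
  shows "heavy (720 * \<kappa>\<^sup>2) 3 x"
    and "a \<noteq> 0 \<Longrightarrow> heavy (720 * \<kappa>\<^sup>2) 1 (A a *v x)"
    and "a \<noteq> 2 \<Longrightarrow> heavy (720 * \<kappa>\<^sup>2) 5 (A a *v x)"
proof -
  obtain w v where x: "x = act w v" and v: "\<forall>i. 1 / \<kappa> \<le> v $ i \<and> v $ i \<le> \<kappa>"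
    using assms(2) by (auto simp: orbit_def)
  have ones: "act w 1 \<in> good_cone" "norm1 (act w 1) > 0"
    using ones_good_cone act_good_cone norm1_act_pos norm1_one by auto
  show "heavy (720 * \<kappa>\<^sup>2) 3 x"
    unfolding x using heavy_act_bounded[OF assms(1) v heavy_cone(1)[OF ones]] by simp
  show "heavy (720 * \<kappa>\<^sup>2) 1 (A a *v x)" if "a \<noteq> 0"
    using heavy_act_bounded[OF assms(1) v, of 720 1 "a # w"] heavy_cone(2)[OF ones that] x by simp
  show "heavy (720 * \<kappa>\<^sup>2) 5 (A a *v x)" if "a \<noteq> 2"
    using heavy_act_bounded[OF assms(1) v, of 720 5 "a # w"] heavy_cone(3)[OF ones that] x by simp
qed

section \<open>Contraction along a sequence\<close>

text \<open>
  The condition on the letter \<open>\<omega> q\<close> that follows the block guarantees that the entry selected by the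
  dominating column is large: after the matrix of 0 the first entry may be small, after the matrix
  of 2 the fifth.
\<close>

definition good_at :: "(nat \<Rightarrow> 3) \<Rightarrow> nat \<Rightarrow> nat \<Rightarrow> bool" where
  "good_at \<omega> p q \<longleftrightarrow> p < q \<and>
     (dominated_by_column 3 (seg \<omega> p q) \<or>
      dominated_by_column 1 (seg \<omega> p q) \<and> \<omega> q \<noteq> 0 \<or>
      dominated_by_column 5 (seg \<omega> p q) \<and> \<omega> q \<noteq> 2)"

lemma good_at_heavy:
  assumes "good_at \<omega> p q" "\<kappa> > 0"
  obtains j where "dominated_by_column j (seg \<omega> p q)"
    "\<And>x. x \<in> orbit \<kappa> \<Longrightarrow> heavy (720 * \<kappa>\<^sup>2) j (A (\<omega> q) *v x)"
  using assms heavy_orbit[OF assms(2)] A_orbit unfolding good_at_def by metis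

text \<open>
  The induction adds blocks on the left: the rightmost block gives a finite \<open>\<eta>\<close>, and each further block
  contracts it.
\<close>

lemma comparable_of_frequently_good:
  assumes good: "\<And>n. \<exists>p\<ge>n. \<exists>q. good_at \<omega> p q" and \<kappa>: "\<kappa> \<ge> 1"
  defines "C \<equiv> 720 * \<kappa>\<^sup>2"
  shows "\<exists>N>n. \<forall>x\<in>orbit \<kappa>. \<forall>y\<in>orbit \<kappa>.
    comparable ((1 - 1 / (8 * C)) ^ m * ((8 * C)\<^sup>2 - 1)) (act (seg \<omega> n N) y) (act (seg \<omega> n N) x)"
proof -
  have C: "C > 0" "8 * C \<ge> 1"
    using one_le_power[OF \<kappa>, of 2] unfolding C_def by linarith+
  show ?thesis
  proof (induction m arbitrary: n)
    case 0
    obtain p q where pq: "p \<ge> n" "good_at \<omega> p q" using good by blast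
    then have "p < q" by (simp add: good_at_def)
    obtain j where j: "dominated_by_column j (seg \<omega> p q)"
      "\<And>x. x \<in> orbit \<kappa> \<Longrightarrow> heavy C j (A (\<omega> q) *v x)"
      using good_at_heavy[OF pq(2), of \<kappa>] \<kappa> by (auto simp: C_def)
    have seg: "seg \<omega> n (Suc q) = seg \<omega> n p @ seg \<omega> p q @ [\<omega> q]"
      using pq(1) \<open>p < q\<close> seg_append[of n p q \<omega>] by (simp add: seg_Suc)
    show ?case
    proof (intro exI[of _ "Suc q"] conjI ballI)
      fix x y assume "x \<in> orbit \<kappa>" "y \<in> orbit \<kappa>"
      then show "comparable ((1 - 1 / (8 * C)) ^ 0 * ((8 * C)\<^sup>2 - 1))
          (act (seg \<omega> n (Suc q)) y) (act (seg \<omega> n (Suc q)) x)"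
        using comparable_act[OF comparable_act_heavy[OF j(1) j(2) j(2) C(1)]] by (simp add: seg)
    qed (use pq(1) \<open>p < q\<close> in simp)
  next
    case (Suc m)
    obtain p q where pq: "p \<ge> n" "good_at \<omega> p q" using good by blast
    then have "p < q" by (simp add: good_at_def)
    obtain j where j: "dominated_by_column j (seg \<omega> p q)"
      "\<And>x. x \<in> orbit \<kappa> \<Longrightarrow> heavy C j (A (\<omega> q) *v x)"
      using good_at_heavy[OF pq(2), of \<kappa>] \<kappa> by (auto simp: C_def)
    obtain N where N: "N > q" "\<And>x y. x \<in> orbit \<kappa> \<Longrightarrow> y \<in> orbit \<kappa> \<Longrightarrow>
      comparable ((1 - 1 / (8 * C)) ^ m * ((8 * C)\<^sup>2 - 1)) (act (seg \<omega> q N) y) (act (seg \<omega> q N) x)"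
      using Suc by blast
    have seg: "seg \<omega> n N = seg \<omega> n p @ seg \<omega> p q @ seg \<omega> q N"
      using pq(1) \<open>p < q\<close> N(1) seg_append[of n p N \<omega>] seg_append[of p q N \<omega>] by simp
    have nonneg: "0 \<le> (1 - 1 / (8 * C)) ^ m * ((8 * C)\<^sup>2 - 1)"
      using C one_le_power[OF C(2), of 2] by (intro mult_nonneg_nonneg) simp_all
    show ?case
    proof (intro exI[of _ N] conjI ballI)
      fix x y assume xy: "x \<in> orbit \<kappa>" "y \<in> orbit \<kappa>"
      have "heavy C j (act (seg \<omega> q N) y)"
        unfolding seg_Cons[OF N(1)] using j(2) act_orbit[OF xy(2)] by simp
      from comparable_act[OF comparable_act_contract[OF j(1) this C N(2)[OF xy] nonneg], of "seg \<omega> n p"]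
      show "comparable ((1 - 1 / (8 * C)) ^ Suc m * ((8 * C)\<^sup>2 - 1))
          (act (seg \<omega> n N) y) (act (seg \<omega> n N) x)"
        unfolding seg act_append by (simp only: power_Suc mult.assoc)
    qed (use pq(1) \<open>p < q\<close> N(1) in simp)
  qed
qed

lemma run_end:
  fixes \<omega> :: "nat \<Rightarrow> 'a"
  assumes "\<omega> p = a" "\<exists>r\<ge>p. \<omega> r \<noteq> a"
  obtains q where "p < q" "\<omega> q \<noteq> a" "\<And>r. p \<le> r \<Longrightarrow> r < q \<Longrightarrow> \<omega> r = a"
proof -
  define q where "q = (LEAST r. r \<ge> p \<and> \<omega> r \<noteq> a)"
  have q: "q \<ge> p" "\<omega> q \<noteq> a"
    unfolding q_def using LeastI_ex[of "\<lambda>r. r \<ge> p \<and> \<omega> r \<noteq> a"] assms(2) by auto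
  have "\<omega> r = a" if "p \<le> r" "r < q" for r
    using not_less_Least[of r "\<lambda>r. r \<ge> p \<and> \<omega> r \<noteq> a"] that by (auto simp: q_def)
  then show thesis using that q assms(1) by (metis le_neq_implies_less)
qed

lemma seg_2: "seg \<omega> p (p + 2) = [\<omega> p, \<omega> (p + 1)]"
  and seg_3: "seg \<omega> p (p + 3) = [\<omega> p, \<omega> (p + 1), \<omega> (p + 2)]"
  and seg_4: "seg \<omega> p (p + 4) = [\<omega> p, \<omega> (p + 1), \<omega> (p + 2), \<omega> (p + 3)]"
  by (simp_all add: seg_def upt_rec numeral_eq_Suc)

text \<open>
  Four zeros followed by another letter are good, whatever precedes them.  A shorter run is good together
  with the letter \<open>\<omega> p\<close> in front of it, the exception being the word 10, which is not in the list; when the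
  letter after it is 1, the word 101 is good instead.  This is where the last assumption enters.
\<close>

lemma good_at_zero_run:
  assumes "\<omega> p \<noteq> 0" "p + 2 \<le> q" "\<And>r. p < r \<Longrightarrow> r < q \<Longrightarrow> \<omega> r = 0" "\<omega> q \<noteq> 0"
    and "\<omega> p = 2 \<or> \<omega> q = 1"
  shows "\<exists>p'\<ge>p. \<exists>q'. good_at \<omega> p' q'"
proof -
  have p: "\<omega> p = 1 \<or> \<omega> p = 2" using assms(1) by (cases "\<omega> p" rule: letter_cases) auto
  consider "q = p + 2" | "q = p + 3" | "q = p + 4" | "q \<ge> p + 5" using assms(2) by linarith
  then show ?thesis
  proof cases
    case 1
    show ?thesis
    proof (cases "\<omega> p = 2")
      case True
      then have "good_at \<omega> p (p + 2)"
        using assms(3,4) 1 dominated_words unfolding good_at_def seg_2 by auto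
      then show ?thesis by blast
    next
      case False
      then have "good_at \<omega> p (p + 3)"
        using p assms(3,5) 1 dominated_words unfolding good_at_def seg_3 by auto
      then show ?thesis by blast
    qed
  next
    case 2
    then have "good_at \<omega> p (p + 3)"
      using p assms(3,4) dominated_words unfolding good_at_def seg_3 by auto
    then show ?thesis by blast
  next
    case 3
    then have "good_at \<omega> p (p + 4)"
      using p assms(3,4) dominated_words unfolding good_at_def seg_4 by auto
    then show ?thesis by blast
  next
    case 4
    define s where "s = q - 4"
    then have s: "q = s + 4" "p < s" using 4 by simp_all
    have "good_at \<omega> s (s + 4)"
      using s assms(3,4) dominated_words unfolding good_at_def seg_4 by auto
    then show ?thesis using s(2) less_imp_le by blast
  qed
qed

text \<open>
  After a letter 2, either 1 follows and 21 is good, or a run of twos ends and 22 is good, or a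
  run of zeros begins, which ends.  If the letter 2 does not occur beyond \<open>n\<close>, then the sequence is binary
  there and contains 1; either it is constantly 1 from there on and 1111 is good, or it contains a run of zeros
  between two ones.
\<close>

lemma frequently_good:
  assumes not0: "\<And>n. \<exists>p\<ge>n. \<omega> p \<noteq> 0" and not2: "\<And>n. \<exists>p\<ge>n. \<omega> p \<noteq> 2"
  shows "\<exists>p\<ge>n. \<exists>q. good_at \<omega> p q"
proof (cases "\<exists>p\<ge>n. \<omega> p = 2")
  case True
  then obtain p where p: "p \<ge> n" "\<omega> p = 2" by blast
  have "\<exists>p'\<ge>p. \<exists>q. good_at \<omega> p' q"
  proof (cases "\<omega> (p + 1)" rule: letter_cases)
    case 1
    obtain q where q: "p + 1 < q" "\<omega> q \<noteq> 0" "\<And>r. p + 1 \<le> r \<Longrightarrow> r < q \<Longrightarrow> \<omega> r = 0"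
      using run_end[OF 1 not0] by blast
    then show ?thesis using p(2) by (intro good_at_zero_run[of \<omega> p q]) auto
  next
    case 2
    then have "good_at \<omega> p (p + 2)" using p(2) dominated_words unfolding good_at_def seg_2 by auto
    then show ?thesis by blast
  next
    case 3
    obtain q where q: "p + 1 < q" "\<omega> q \<noteq> 2" "\<And>r. p + 1 \<le> r \<Longrightarrow> r < q \<Longrightarrow> \<omega> r = 2"
      using run_end[OF 3 not2] by blast
    define s where "s = q - 2"
    then have s: "q = s + 2" "p \<le> s" using q(1) by simp_all
    have "\<omega> s = 2" using q(3)[of s] p(2) s by (cases "s = p") auto
    then have "good_at \<omega> s (s + 2)"
      using q s dominated_words unfolding good_at_def seg_2 by auto
    then show ?thesis using s(2) by blast
  qed
  then show ?thesis using p(1) order.trans by blast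
next
  case False
  then have binary: "\<omega> r = 0 \<or> \<omega> r = 1" if "r \<ge> n" for r
    using that by (cases "\<omega> r" rule: letter_cases) auto
  obtain p where p: "p \<ge> n" "\<omega> p = 1" using not0[of n] binary by blast
  have "\<exists>p'\<ge>p. \<exists>q. good_at \<omega> p' q"
  proof (cases "\<exists>r\<ge>p. \<omega> r \<noteq> 1")
    case False
    then have "good_at \<omega> p (p + 4)" using dominated_words unfolding good_at_def seg_4 by auto
    then show ?thesis by blast
  next
    case True
    obtain s where s: "p < s" "\<omega> s \<noteq> 1" "\<And>r. p \<le> r \<Longrightarrow> r < s \<Longrightarrow> \<omega> r = 1"
      using run_end[OF p(2) True] by blast
    have s0: "\<omega> s = 0" using binary[of s] s p(1) by auto
    obtain q where q: "s < q" "\<omega> q \<noteq> 0" "\<And>r. s \<le> r \<Longrightarrow> r < q \<Longrightarrow> \<omega> r = 0"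
      using run_end[OF s0 not0] by blast
    have "\<exists>p'\<ge>s - 1. \<exists>q'. good_at \<omega> p' q'"
      using s q binary[of q] p(1) by (intro good_at_zero_run[of \<omega> "s - 1" q]) auto
    moreover have "p \<le> s - 1" using s(1) by simp
    ultimately show ?thesis using order.trans by blast
  qed
  then show ?thesis using p(1) order.trans by blast
qed

text \<open>
  The directions of the images of the whole orbit set converge to each other along \<open>\<omega>\<close>.
\<close>

definition collapses :: "real \<Rightarrow> (nat \<Rightarrow> 3) \<Rightarrow> bool" where
  "collapses \<kappa> \<omega> \<longleftrightarrow> (\<forall>\<epsilon>>0. \<exists>N. \<forall>x\<in>orbit \<kappa>. \<forall>y\<in>orbit \<kappa>.
     norm1 (normalize1 (act (seg \<omega> 0 N) x) - normalize1 (act (seg \<omega> 0 N) y)) < \<epsilon>)"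

lemma collapses_of_frequently_good:
  assumes "\<And>n. \<exists>p\<ge>n. \<exists>q. good_at \<omega> p q" "\<kappa> \<ge> 1"
  shows "collapses \<kappa> \<omega>"
  unfolding collapses_def
proof (intro allI impI)
  fix \<epsilon> :: real assume "\<epsilon> > 0"
  define C where "C = 720 * \<kappa>\<^sup>2"
  have C: "C \<ge> 720" using one_le_power[OF assms(2), of 2] by (simp add: C_def)
  have sq: "(8 * C)\<^sup>2 \<ge> 1" using C by (intro one_le_power) simp
  define \<theta> D where "\<theta> = 1 - 1 / (8 * C)" and "D = (8 * C)\<^sup>2 - 1"
  have \<theta>: "0 \<le> \<theta>" "\<theta> < 1" using C by (simp_all add: \<theta>_def)
  have "(\<lambda>m. \<theta> ^ m * D) \<longlonglongrightarrow> 0 * D"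
    using \<theta> by (intro tendsto_intros LIMSEQ_power_zero) simp
  then have "eventually (\<lambda>m. \<theta> ^ m * D < \<epsilon>) sequentially"
    using \<open>\<epsilon> > 0\<close> by (intro order_tendstoD(2)[of _ "0 * D"]) simp_all
  then obtain m where m: "\<theta> ^ m * D < \<epsilon>" by (auto simp: eventually_sequentially)
  obtain N where N: "\<forall>x\<in>orbit \<kappa>. \<forall>y\<in>orbit \<kappa>.
      comparable (\<theta> ^ m * D) (act (seg \<omega> 0 N) y) (act (seg \<omega> 0 N) x)"
    using comparable_of_frequently_good[OF assms, of 0 m] unfolding \<theta>_def D_def C_def by blast
  show "\<exists>N. \<forall>x\<in>orbit \<kappa>. \<forall>y\<in>orbit \<kappa>.
     norm1 (normalize1 (act (seg \<omega> 0 N) x) - normalize1 (act (seg \<omega> 0 N) y)) < \<epsilon>"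
  proof (intro exI[of _ N] ballI)
    fix x y assume xy: "x \<in> orbit \<kappa>" "y \<in> orbit \<kappa>"
    have "heavy (720 * \<kappa>\<^sup>2) 3 (act (seg \<omega> 0 N) y)"
      using assms(2) act_orbit[OF xy(2)] by (intro heavy_orbit(1)) auto
    then have "norm1 (normalize1 (act (seg \<omega> 0 N) x) - normalize1 (act (seg \<omega> 0 N) y)) \<le> \<theta> ^ m * D"
      using N xy \<theta> sq by (intro norm1_normalize1_diff_comparable) (auto simp: heavy_def D_def)
    with m show "norm1 (normalize1 (act (seg \<omega> 0 N) x) - normalize1 (act (seg \<omega> 0 N) y)) < \<epsilon>"
      by simp
  qed
qed

section \<open>Sequences that are eventually 0 or eventually 2\<close>

text \<open>
  The letter 0 moves entries around the cycle \<open>5 \<rightarrow> 3 \<rightarrow> 2 \<rightarrow> 7 \<rightarrow> 5\<close>, with a copy of 5 in position 6, and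
  adds the constant first entry to position 5 at each step.  Each entry of the cycle hence grows by a
  quarter of the first entry per step.  The letter 2 adds the constant fifth entry to positions
  1 and 4 at each step, and position 3 follows position 1.
\<close>

definition growth0 :: "real^7" where
  "growth0 = (1 / 4) *\<^sub>R (U 2 + U 3 + U 5 + U 6 + U 7)"

definition growth2 :: "real^7" where
  "growth2 = U 1 + U 3 + U 4"

lemma growth0_nth [simp]:
  "growth0 $ 1 = 0" "growth0 $ 2 = 1/4" "growth0 $ 3 = 1/4" "growth0 $ 4 = 0"
  "growth0 $ 5 = 1/4" "growth0 $ 6 = 1/4" "growth0 $ 7 = 1/4"
  by (simp_all add: growth0_def U_def axis_def)

lemma growth2_nth [simp]:
  "growth2 $ 1 = 1" "growth2 $ 2 = 0" "growth2 $ 3 = 1" "growth2 $ 4 = 1"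
  "growth2 $ 5 = 0" "growth2 $ 6 = 0" "growth2 $ 7 = 0"
  by (simp_all add: growth2_def U_def axis_def)

lemma growth_good_cone: "growth0 \<in> good_cone" "growth2 \<in> good_cone"
  by (simp_all add: good_cone_def less_eq_vec_def all_7)

lemma norm1_growth: "norm1 growth0 = 5 / 4" "norm1 growth2 = 3"
  by (simp_all add: norm1_7)

lemma norm1_le_bound: "\<forall>i. \<bar>x $ i\<bar> \<le> b \<Longrightarrow> norm1 x \<le> 7 * b"
  using sum_bounded_above[of UNIV "\<lambda>i. \<bar>x $ i\<bar>" b] by (simp add: norm1_def)

text \<open>
  The offsets 3, 2, 1, 0 follow the order of the cycle and make the estimate invariant under one step.
  The fourth entry is added to the third once and then vanishes; subtracting it from the bound
  accounts for that.
\<close>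

lemma act_replicate_0:
  fixes n :: nat
  assumes z: "0 \<le> z"
  defines "y \<equiv> \<lambda>n. act (replicate n 0) z" and "B \<equiv> 2 * norm1 z"
  shows "y n $ 1 = z $ 1 \<and> 0 \<le> y n $ 4 \<and>
    \<bar>y n $ 2 - (n + 1) / 4 * z $ 1\<bar> \<le> B - y n $ 4 \<and>
    \<bar>y n $ 3 - (n + 2) / 4 * z $ 1\<bar> \<le> B - y n $ 4 \<and>
    \<bar>y n $ 5 - (n + 3) / 4 * z $ 1\<bar> \<le> B - y n $ 4 \<and>
    \<bar>y n $ 6 - (n + 2) / 4 * z $ 1\<bar> \<le> B - y n $ 4 \<and>
    \<bar>y n $ 7 - n / 4 * z $ 1\<bar> \<le> B - y n $ 4"
proof (induction n)
  case 0
  have "z $ i \<ge> 0" for i using z by (simp add: less_eq_vec_def)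
  note this[of 1] this[of 2] this[of 3] this[of 4] this[of 5] this[of 6] this[of 7]
  moreover have "norm1 z = z$1 + z$2 + z$3 + z$4 + z$5 + z$6 + z$7"
    using norm1_eq_sum[OF z] by (simp only: sum_7)
  ultimately show ?case unfolding y_def B_def by (simp add: abs_le_iff)
next
  case (Suc n)
  have y: "y (Suc n) = A 0 *v y n" by (simp add: y_def)
  show ?case using Suc unfolding y A_mult_0
    by (auto simp: algebra_simps add_divide_distrib abs_le_iff)
qed

lemma norm1_act_replicate_0:
  fixes n :: nat
  assumes z: "0 \<le> z"
  shows "norm1 (act (replicate n 0) z - (n * z $ 1) *\<^sub>R growth0) \<le> 21 * norm1 z"
proof -
  have "z $ 1 \<ge> 0" "z $ 1 \<le> norm1 z"
    using z component_le_norm1[of z 1] by (simp_all add: less_eq_vec_def)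
  then have "\<forall>i. \<bar>(act (replicate n 0) z - (n * z $ 1) *\<^sub>R growth0) $ i\<bar> \<le> 3 * norm1 z"
    using act_replicate_0[OF z, of n] unfolding all_7
    by (auto simp: abs_le_iff algebra_simps add_divide_distrib)
  from norm1_le_bound[OF this] show ?thesis by simp
qed

text \<open>
  The seventh entry is added to the first and the third once and then vanishes; it is subtracted from the
  bound for that reason.
\<close>

lemma act_replicate_2:
  fixes n :: nat
  assumes z: "0 \<le> z"
  defines "y \<equiv> \<lambda>n. act (replicate n 2) z" and "B \<equiv> 2 * norm1 z"
  shows "y n $ 5 = z $ 5 \<and> 0 \<le> y n $ 7 \<and> y n $ 7 \<le> B \<and>
    0 \<le> y n $ 2 \<and> y n $ 2 \<le> B \<and> 0 \<le> y n $ 6 \<and> y n $ 6 \<le> B \<and>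
    \<bar>y n $ 1 - n * z $ 5\<bar> \<le> B - y n $ 7 \<and>
    \<bar>y n $ 3 - (real n - 1) * z $ 5\<bar> \<le> B - y n $ 7 \<and>
    \<bar>y n $ 4 - n * z $ 5\<bar> \<le> B"
proof (induction n)
  case 0
  have "z $ i \<ge> 0" for i using z by (simp add: less_eq_vec_def)
  note this[of 1] this[of 2] this[of 3] this[of 4] this[of 5] this[of 6] this[of 7]
  moreover have "norm1 z = z$1 + z$2 + z$3 + z$4 + z$5 + z$6 + z$7"
    using norm1_eq_sum[OF z] by (simp only: sum_7)
  ultimately show ?case unfolding y_def B_def by (simp add: abs_le_iff)
next
  case (Suc n)
  have y: "y (Suc n) = A 2 *v y n" by (simp add: y_def)
  show ?case using Suc unfolding y A_mult_2
    by (auto simp: algebra_simps abs_le_iff)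
qed

lemma norm1_act_replicate_2:
  fixes n :: nat
  assumes z: "0 \<le> z"
  shows "norm1 (act (replicate n 2) z - (n * z $ 5) *\<^sub>R growth2) \<le> 21 * norm1 z"
proof -
  have "z $ 5 \<ge> 0" "z $ 5 \<le> norm1 z"
    using z component_le_norm1[of z 5] by (simp_all add: less_eq_vec_def)
  then have "\<forall>i. \<bar>(act (replicate n 2) z - (n * z $ 5) *\<^sub>R growth2) $ i\<bar> \<le> 3 * norm1 z"
    using act_replicate_2[OF z, of n] unfolding all_7
    by (auto simp: abs_le_iff algebra_simps add_divide_distrib)
  from norm1_le_bound[OF this] show ?thesis by simp
qed

text \<open>
  Linear growth needs a starting vector whose entry \<open>j\<close> is large, and this fails after many letters \<open>a\<close>.  These
  are removed from \<open>x\<close> and added to the power of the matrix of \<open>a\<close> instead.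
\<close>

lemma orbit_strip:
  assumes "\<kappa> > 0" "x \<in> orbit \<kappa>"
    and step: "\<And>b y. b \<noteq> a \<Longrightarrow> y \<in> orbit \<kappa> \<Longrightarrow> heavy (720 * \<kappa>\<^sup>2) j (A b *v y)"
  obtains m z where "x = act (replicate m a) z" "heavy (720 * \<kappa>\<^sup>2) j z"
proof -
  obtain w v where x: "x = act w v" and v: "\<forall>i. 1 / \<kappa> \<le> v $ i \<and> v $ i \<le> \<kappa>"
    using assms(2) by (auto simp: orbit_def)
  have "\<exists>m z. act w v = act (replicate m a) z \<and> heavy (720 * \<kappa>\<^sup>2) j z"
  proof (induction w)
    case Nil
    have "heavy 720 j (act [] 1)" by (simp add: heavy_def norm1_one less_eq_vec_def)
    then have "heavy (720 * \<kappa>\<^sup>2) j v" using heavy_act_bounded[OF assms(1) v, of 720 j "[]"] by simp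
    then show ?case by (intro exI[of _ 0] exI[of _ v]) simp
  next
    case (Cons b w)
    show ?case
    proof (cases "b = a")
      case True
      obtain m z where "act w v = act (replicate m a) z" "heavy (720 * \<kappa>\<^sup>2) j z"
        using Cons by blast
      then show ?thesis using True by (intro exI[of _ "Suc m"] exI[of _ z]) simp
    next
      case False
      have "act w v \<in> orbit \<kappa>" using v by (auto simp: orbit_def)
      then show ?thesis using step[OF False] by (intro exI[of _ 0] exI[of _ "act (b # w) v"]) simp
    qed
  qed
  then show thesis using that x by blast
qed

lemma seg_const:
  assumes "\<And>r. p \<le> r \<Longrightarrow> r < p + n \<Longrightarrow> \<omega> r = a"
  shows "seg \<omega> p (p + n) = replicate n a"
proof -
  have "map \<omega> [p..<p + n] = map (\<lambda>_. a) [p..<p + n]" using assms by (intro map_cong) auto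
  then show ?thesis by (simp add: seg_def map_replicate_const)
qed

text \<open>
  As \<open>E\<close> lies in the cone, \<open>A(u) E\<close> is nonzero for the fixed prefix \<open>u\<close>, so that convergence of the
  directions to that of \<open>E\<close> survives the application of \<open>A(u)\<close>.
\<close>

lemma eventually_const_rate:
  assumes \<kappa>: "\<kappa> > 0" and const: "\<And>r. p \<le> r \<Longrightarrow> \<omega> r = a"
    and E: "E \<in> good_cone" "norm1 E > 0"
    and growth: "\<And>n z. 0 \<le> z \<Longrightarrow>
      norm1 (act (replicate n a) z - (n * z $ j) *\<^sub>R E) \<le> 21 * norm1 z"
    and step: "\<And>b y. b \<noteq> a \<Longrightarrow> y \<in> orbit \<kappa> \<Longrightarrow> heavy (720 * \<kappa>\<^sup>2) j (A b *v y)"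
  shows "\<exists>D. \<forall>n>0. \<forall>x\<in>orbit \<kappa>.
    norm1 (normalize1 (act (seg \<omega> 0 (p + n)) x) - normalize1 (act (seg \<omega> 0 p) E)) \<le> D / real n"
proof -
  define C u L where "C = 720 * \<kappa>\<^sup>2" and "u = seg \<omega> 0 p" and "L = norm1 (act u E)"
  have L: "L > 0" unfolding L_def by (rule norm1_act_pos[OF E])
  have "C > 0" using \<kappa> by (simp add: C_def)
  define D where "D = 2 * (3 ^ length u * (21 * C)) / L"
  have "D \<ge> 0" using \<open>C > 0\<close> L by (simp add: D_def)
  have "norm1 (normalize1 (act (seg \<omega> 0 (p + n)) x) - normalize1 (act u E)) \<le> D / real n"
    if n: "n > 0" and x: "x \<in> orbit \<kappa>" for n x
  proof -
    obtain m z where z: "x = act (replicate m a) z" "heavy C j z"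
      using orbit_strip[OF \<kappa> x step] unfolding C_def by blast
    define k where "k = n + m"
    have zj: "z $ j > 0" using heavy_pos[OF z(2) \<open>C > 0\<close>] .
    have k: "k > 0" "n \<le> k" using n by (simp_all add: k_def)
    define s X where "s = k * z $ j" and "X = act (replicate k a) z"
    have s: "s > 0" using k zj by (simp add: s_def)
    have X: "act (seg \<omega> 0 (p + n)) x = act u X"
      using seg_append[of 0 p "p + n" \<omega>] seg_const[of p n \<omega> a] const
      by (simp add: u_def X_def z(1) k_def replicate_add)
    have "heavy C 3 (act u X)"
      unfolding X[symmetric] C_def by (intro heavy_orbit(1) \<kappa> act_orbit x)
    then have "norm1 (act u X) > 0" by (simp add: heavy_def)
    have "norm1 (act u X - s *\<^sub>R act u E) = norm1 (act u (X - s *\<^sub>R E))"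
      by (simp add: act_diff act_scaleR)
    also have "\<dots> \<le> 3 ^ length u * norm1 (X - s *\<^sub>R E)" by (rule norm1_act_le)
    also have "\<dots> \<le> 3 ^ length u * (21 * norm1 z)"
      using growth[of z k] z(2) by (simp add: s_def X_def heavy_def)
    also have "\<dots> \<le> 3 ^ length u * (21 * (C * z $ j))"
      using z(2) by (simp add: heavy_def)
    finally have diff: "norm1 (act u X - s *\<^sub>R act u E) \<le> 3 ^ length u * (21 * (C * z $ j))" .
    have "norm1 (normalize1 (act u X) - normalize1 (act u E))
        = norm1 (normalize1 (act u X) - normalize1 (s *\<^sub>R act u E))"
      using s by (simp add: normalize1_scaleR)
    also have "\<dots> \<le> 2 * norm1 (act u X - s *\<^sub>R act u E) / norm1 (s *\<^sub>R act u E)"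
      using \<open>norm1 (act u X) > 0\<close> s L
      by (intro norm1_diff_normalize1) (simp_all add: norm1_scaleR L_def)
    also have "\<dots> = 2 * norm1 (act u X - s *\<^sub>R act u E) / (s * L)"
      using s by (simp add: norm1_scaleR L_def)
    also have "\<dots> \<le> 2 * (3 ^ length u * (21 * (C * z $ j))) / (s * L)"
      using diff s L by (intro divide_right_mono mult_left_mono) simp_all
    also have "\<dots> = D / k" using zj L by (simp add: D_def s_def field_simps)
    also have "\<dots> \<le> D / n" using k n \<open>D \<ge> 0\<close> by (intro divide_left_mono) simp_all
    finally show ?thesis by (simp add: X)
  qed
  then show ?thesis by (auto simp: u_def)
qed

lemma eventually_0_rate:
  assumes "\<kappa> > 0" "\<And>r. p \<le> r \<Longrightarrow> \<omega> r = 0"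
  shows "\<exists>D. \<forall>n>0. \<forall>x\<in>orbit \<kappa>.
    norm1 (normalize1 (act (seg \<omega> 0 (p + n)) x) - normalize1 (act (seg \<omega> 0 p) growth0)) \<le> D / real n"
  using norm1_act_replicate_0 heavy_orbit(2)[OF assms(1)]
  by (intro eventually_const_rate[where E = growth0 and j = 1, OF assms] growth_good_cone)
     (simp_all add: norm1_growth)

lemma eventually_2_rate:
  assumes "\<kappa> > 0" "\<And>r. p \<le> r \<Longrightarrow> \<omega> r = 2"
  shows "\<exists>D. \<forall>n>0. \<forall>x\<in>orbit \<kappa>.
    norm1 (normalize1 (act (seg \<omega> 0 (p + n)) x) - normalize1 (act (seg \<omega> 0 p) growth2)) \<le> D / real n"
  using norm1_act_replicate_2 heavy_orbit(3)[OF assms(1)]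
  by (intro eventually_const_rate[where E = growth2 and j = 5, OF assms] growth_good_cone)
     (simp_all add: norm1_growth)

lemma collapses_of_rate:
  assumes "\<exists>D. \<forall>n>0. \<forall>x\<in>orbit \<kappa>. norm1 (normalize1 (act (seg \<omega> 0 (p + n)) x) - L) \<le> D / real n"
  shows "collapses \<kappa> \<omega>"
  unfolding collapses_def
proof (intro allI impI)
  fix \<epsilon> :: real assume "\<epsilon> > 0"
  obtain D where D: "\<forall>n>0. \<forall>x\<in>orbit \<kappa>.
      norm1 (normalize1 (act (seg \<omega> 0 (p + n)) x) - L) \<le> D / real n"
    using assms by blast
  obtain n :: nat where n: "2 * \<bar>D\<bar> / \<epsilon> < n" using reals_Archimedean2 by blast
  have "0 \<le> 2 * \<bar>D\<bar> / \<epsilon>" using \<open>\<epsilon> > 0\<close> by simp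
  then have "n > 0" using n by (cases n) auto
  have "D / n \<le> \<bar>D\<bar> / n" by (simp add: divide_right_mono)
  also have "\<dots> < \<epsilon> / 2" using n \<open>n > 0\<close> \<open>\<epsilon> > 0\<close> by (simp add: field_simps)
  finally have small: "D / n < \<epsilon> / 2" .
  show "\<exists>N. \<forall>x\<in>orbit \<kappa>. \<forall>y\<in>orbit \<kappa>.
     norm1 (normalize1 (act (seg \<omega> 0 N) x) - normalize1 (act (seg \<omega> 0 N) y)) < \<epsilon>"
  proof (intro exI[of _ "p + n"] ballI)
    fix x y assume xy: "x \<in> orbit \<kappa>" "y \<in> orbit \<kappa>"
    let ?f = "\<lambda>x. normalize1 (act (seg \<omega> 0 (p + n)) x)"
    have "norm1 (?f x - ?f y) \<le> norm1 (?f x - L) + norm1 (L - ?f y)"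
      using norm1_triangle[of "?f x - L" "L - ?f y"] by simp
    also have "norm1 (L - ?f y) = norm1 (?f y - L)"
      using norm1_scaleR[of "-1" "?f y - L"] by simp
    finally show "norm1 (?f x - ?f y) < \<epsilon>"
      using D \<open>n > 0\<close> xy small by (smt (verit) field_sum_of_halves)
  qed
qed

section \<open>Uniformity by compactness\<close>

lemma orbit_collapses:
  assumes "\<kappa> \<ge> 1"
  shows "collapses \<kappa> \<omega>"
proof -
  have \<kappa>: "\<kappa> > 0" using assms by simp
  consider p where "\<And>r. p \<le> r \<Longrightarrow> \<omega> r = 0" | p where "\<And>r. p \<le> r \<Longrightarrow> \<omega> r = 2"
    | "\<And>n. \<exists>p\<ge>n. \<omega> p \<noteq> 0" "\<And>n. \<exists>p\<ge>n. \<omega> p \<noteq> 2"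
    by blast
  then show ?thesis
  proof cases
    case 1
    then show ?thesis by (rule collapses_of_rate[OF eventually_0_rate[OF \<kappa>]])
  next
    case 2
    then show ?thesis by (rule collapses_of_rate[OF eventually_2_rate[OF \<kappa>]])
  next
    case 3
    then show ?thesis by (intro collapses_of_frequently_good frequently_good assms)
  qed
qed

text \<open>
  Koenig's lemma: the branch is built by always choosing a letter above which the tree has arbitrarily
  long words.
\<close>

lemma konig_prefixes:
  fixes P :: "'a::finite list \<Rightarrow> bool"
  assumes prefix: "\<And>u v. P (u @ v) \<Longrightarrow> P u" and long: "\<And>n. \<exists>u. length u = n \<and> P u"
  shows "\<exists>\<omega>. \<forall>n. P (map \<omega> [0..<n])"
proof -
  define Q where "Q u \<longleftrightarrow> (\<forall>n. \<exists>v. length v = n \<and> P (u @ v))" for u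
  have extend: "\<exists>a. Q (u @ [a])" if "Q u" for u
  proof (rule ccontr)
    assume "\<nexists>a. Q (u @ [a])"
    then obtain f where f: "\<And>a v. length v = f a \<Longrightarrow> \<not> P ((u @ [a]) @ v)"
      unfolding Q_def by metis
    obtain v where v: "length v = Suc (Max (range f))" "P (u @ v)" using \<open>Q u\<close> unfolding Q_def by blast
    then obtain a v' where v': "v = a # v'" "length v' = Max (range f)" by (cases v) auto
    \<comment> \<open>above each letter the tree dies out at level \<open>f a\<close>, but \<open>v'\<close> is at least that long\<close>
    have "f a \<le> length v'" unfolding v'(2) by (intro Max_ge) auto
    have "P (((u @ [a]) @ take (f a) v') @ drop (f a) v')" using v(2) v'(1) by simp
    then have "P ((u @ [a]) @ take (f a) v')" by (rule prefix)
    then show False using f[of "take (f a) v'" a] \<open>f a \<le> length v'\<close> by simp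
  qed
  define pre where "pre = rec_nat [] (\<lambda>_ u. u @ [SOME a. Q (u @ [a])])"
  define \<omega> where "\<omega> n = (SOME a. Q (pre n @ [a]))" for n
  have pre: "pre 0 = []" "pre (Suc n) = pre n @ [\<omega> n]" for n
    by (simp_all add: pre_def \<omega>_def)
  have "Q (pre n)" for n
  proof (induction n)
    case 0
    show ?case using long by (simp add: Q_def pre)
  next
    case (Suc n)
    show ?case unfolding pre \<omega>_def by (rule someI_ex[OF extend[OF Suc]])
  qed
  moreover have "pre n = map \<omega> [0..<n]" for n by (induction n) (simp_all add: pre)
  ultimately have "P (map \<omega> [0..<n])" for n
    unfolding Q_def by (metis append_Nil2 length_0_conv)
  then show ?thesis by blast
qed

lemma orbit_collapses_uniformly:
  assumes "\<kappa> \<ge> 1" "\<epsilon> > 0"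
  shows "\<exists>N. \<forall>\<omega>. \<forall>n\<ge>N. \<forall>x\<in>orbit \<kappa>. \<forall>y\<in>orbit \<kappa>.
     norm1 (normalize1 (act (seg \<omega> 0 n) x) - normalize1 (act (seg \<omega> 0 n) y)) < \<epsilon>"
proof (rule ccontr)
  assume contra: "\<not> ?thesis"
  define P where "P u \<longleftrightarrow> (\<exists>x\<in>orbit \<kappa>. \<exists>y\<in>orbit \<kappa>.
    \<not> norm1 (normalize1 (act u x) - normalize1 (act u y)) < \<epsilon>)" for u
  have prefix: "P u" if "P (u @ v)" for u v
    using that act_orbit unfolding P_def by fastforce
  have "\<exists>u. length u = n \<and> P u" for n
  proof -
    obtain \<omega> m where m: "m \<ge> n" "P (seg \<omega> 0 m)" using contra unfolding P_def by blast
    then have "P (seg \<omega> 0 n)" using prefix[of "seg \<omega> 0 n" "seg \<omega> n m"] seg_append[of 0 n m \<omega>] by simp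
    then show ?thesis by (intro exI[of _ "seg \<omega> 0 n"]) (simp add: seg_def)
  qed
  then obtain \<omega> where \<omega>: "\<And>n. P (seg \<omega> 0 n)" using konig_prefixes[of P] prefix by (auto simp: seg_def)
  obtain N where "\<not> P (seg \<omega> 0 N)"
    using orbit_collapses[OF assms(1), of \<omega>] assms(2) unfolding collapses_def P_def by blast
  with \<omega> show False by blast
qed

section \<open>The limit and its support\<close>

lemma one_in_orbit: "\<kappa> \<ge> 1 \<Longrightarrow> 1 \<in> orbit \<kappa>"
  unfolding orbit_def by (auto intro!: exI[of _ "[]"] exI[of _ 1])

lemma positive_in_orbit:
  assumes "\<forall>i. V $ i > 0"
  obtains \<kappa> where "\<kappa> \<ge> 1" "V \<in> orbit \<kappa>"
proof -
  define \<kappa> where "\<kappa> = 1 + (\<Sum>i\<in>UNIV. V $ i + 1 / V $ i)"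
  have pos: "V $ i > 0" for i using assms by blast
  have "0 \<le> (\<Sum>i\<in>UNIV. V $ i + 1 / V $ i)"
    by (intro sum_nonneg add_nonneg_nonneg) (simp_all add: pos less_imp_le)
  then have "\<kappa> \<ge> 1" by (simp add: \<kappa>_def)
  have summand: "V $ i + 1 / V $ i \<le> \<kappa>" for i
    using member_le_sum[of i UNIV "\<lambda>i. V $ i + 1 / V $ i"] pos
    by (simp add: \<kappa>_def add_nonneg_nonneg less_imp_le)
  have "1 / \<kappa> \<le> V $ i" "V $ i \<le> \<kappa>" for i
  proof -
    have "1 / V $ i \<le> \<kappa>" using summand[of i] pos[of i] by simp
    then show "1 / \<kappa> \<le> V $ i" using pos[of i] \<open>\<kappa> \<ge> 1\<close> by (simp add: field_simps)
    show "V $ i \<le> \<kappa>" using summand[of i] pos[of i] by (smt (verit) divide_pos_pos)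
  qed
  then have "V \<in> orbit \<kappa>" unfolding orbit_def by (auto intro!: exI[of _ "[]"])
  with \<open>\<kappa> \<ge> 1\<close> that show thesis by blast
qed

lemma norm_le_norm1: "norm (x :: real^7) \<le> norm1 x"
  unfolding norm1_def by (rule norm_le_l1_cart)

text \<open>
  The sets \<open>orbit \<kappa>\<close> are closed under the matrices, so the factors after the first \<open>N\<close> can be absorbed into
  the vector.  Comparing two initial vectors and two lengths at once gives both the Cauchy property
  and the independence of the limit from \<open>V\<close>.
\<close>

lemma Pi_seq_uniformly_close:
  assumes "\<kappa> \<ge> 1" "\<epsilon> > 0"
  obtains N where "\<And>\<omega> m n V W. m \<ge> N \<Longrightarrow> n \<ge> N \<Longrightarrow> V \<in> orbit \<kappa> \<Longrightarrow> W \<in> orbit \<kappa> \<Longrightarrow>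
    dist (Pi_seq m \<omega> V) (Pi_seq n \<omega> W) < \<epsilon>"
proof -
  obtain N where N: "\<And>\<omega> x y. x \<in> orbit \<kappa> \<Longrightarrow> y \<in> orbit \<kappa> \<Longrightarrow>
      norm1 (normalize1 (act (seg \<omega> 0 N) x) - normalize1 (act (seg \<omega> 0 N) y)) < \<epsilon>"
    using orbit_collapses_uniformly[OF assms] by blast
  have split: "Pi_seq n \<omega> V = normalize1 (act (seg \<omega> 0 N) (act (seg \<omega> N n) V))" if "n \<ge> N" for n \<omega> V
    using seg_append[of 0 N n \<omega>] that by (simp add: Pi_seq_eq)
  have "dist (Pi_seq m \<omega> V) (Pi_seq n \<omega> W) < \<epsilon>"
    if "m \<ge> N" "n \<ge> N" "V \<in> orbit \<kappa>" "W \<in> orbit \<kappa>" for \<omega> m n V W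
    unfolding split[OF that(1)] split[OF that(2)] dist_norm
    using norm_le_norm1 N[OF act_orbit[OF that(3)] act_orbit[OF that(4)]] by (rule le_less_trans)
  then show thesis by (rule that)
qed

definition limit_vector :: "(nat \<Rightarrow> 3) \<Rightarrow> real^7" where
  "limit_vector \<omega> = lim (\<lambda>n. Pi_seq n \<omega> 1)"

lemma Pi_seq_tendsto_limit_vector: "(\<lambda>n. Pi_seq n \<omega> 1) \<longlonglongrightarrow> limit_vector \<omega>"
proof -
  have "Cauchy (\<lambda>n. Pi_seq n \<omega> 1)"
  proof (rule metric_CauchyI)
    fix \<epsilon> :: real assume "\<epsilon> > 0"
    obtain N where "\<And>\<omega> m n V W. m \<ge> N \<Longrightarrow> n \<ge> N \<Longrightarrow> V \<in> orbit 1 \<Longrightarrow> W \<in> orbit 1 \<Longrightarrow>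
        dist (Pi_seq m \<omega> V) (Pi_seq n \<omega> W) < \<epsilon>"
      using Pi_seq_uniformly_close[of 1, OF _ \<open>\<epsilon> > 0\<close>] by auto
    then show "\<exists>M. \<forall>m\<ge>M. \<forall>n\<ge>M. dist (Pi_seq m \<omega> 1) (Pi_seq n \<omega> 1) < \<epsilon>"
      using one_in_orbit[of 1] by blast
  qed
  then show ?thesis unfolding limit_vector_def by (simp add: Cauchy_convergent_iff convergent_LIMSEQ_iff)
qed

lemma Pi_seq_uniform_limit:
  assumes "\<forall>i. V $ i > 0"
  shows "uniform_limit UNIV (\<lambda>n \<omega>. Pi_seq n \<omega> V) limit_vector sequentially"
proof (rule uniform_limitI)
  fix \<epsilon> :: real assume "\<epsilon> > 0"
  obtain \<kappa> where \<kappa>: "\<kappa> \<ge> 1" "V \<in> orbit \<kappa>" using positive_in_orbit[OF assms] .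
  obtain N where N: "\<And>\<omega> m n V W. m \<ge> N \<Longrightarrow> n \<ge> N \<Longrightarrow> V \<in> orbit \<kappa> \<Longrightarrow> W \<in> orbit \<kappa> \<Longrightarrow>
      dist (Pi_seq m \<omega> V) (Pi_seq n \<omega> W) < \<epsilon> / 2"
    using Pi_seq_uniformly_close[OF \<kappa>(1), of "\<epsilon> / 2"] \<open>\<epsilon> > 0\<close> by auto
  have "dist (Pi_seq n \<omega> V) (limit_vector \<omega>) < \<epsilon>" if "n \<ge> N" for n \<omega>
  proof -
    have "(\<lambda>m. dist (Pi_seq n \<omega> V) (Pi_seq m \<omega> 1)) \<longlonglongrightarrow> dist (Pi_seq n \<omega> V) (limit_vector \<omega>)"
      by (intro tendsto_intros Pi_seq_tendsto_limit_vector)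
    then have "dist (Pi_seq n \<omega> V) (limit_vector \<omega>) \<le> \<epsilon> / 2"
    proof (rule LIMSEQ_le_const2)
      show "\<exists>M. \<forall>m\<ge>M. dist (Pi_seq n \<omega> V) (Pi_seq m \<omega> 1) \<le> \<epsilon> / 2"
        using N[OF that _ \<kappa>(2) one_in_orbit[OF \<kappa>(1)]] less_imp_le by blast
    qed
    then show ?thesis using \<open>\<epsilon> > 0\<close> by linarith
  qed
  then show "\<forall>\<^sub>F n in sequentially. \<forall>\<omega>\<in>UNIV. dist (Pi_seq n \<omega> V) (limit_vector \<omega>) < \<epsilon>"
    unfolding eventually_sequentially by blast
qed

lemma heavy_act_ones: "heavy 720 3 (act w 1)"
  using heavy_orbit(1)[OF _ act_orbit[OF one_in_orbit[of 1]]] by simp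

lemma probability_vector_limit_vector: "probability_vector (limit_vector \<omega>)"
  unfolding probability_vector_def
proof (intro conjI allI)
  have comp: "(\<lambda>n. Pi_seq n \<omega> 1 $ i) \<longlonglongrightarrow> limit_vector \<omega> $ i" for i
    by (intro tendsto_intros Pi_seq_tendsto_limit_vector)
  have h: "heavy 720 3 (act (seg \<omega> 0 n) 1)" for n by (rule heavy_act_ones)
  have "Pi_seq n \<omega> 1 $ i \<ge> 0" for n i
    using h[of n] by (simp add: Pi_seq_eq normalize1_def heavy_def less_eq_vec_def)
  then show "0 \<le> limit_vector \<omega> $ i" for i using comp[of i] by (auto intro: LIMSEQ_le_const)
  have "(\<lambda>n. norm1 (Pi_seq n \<omega> 1)) \<longlonglongrightarrow> norm1 (limit_vector \<omega>)"
    unfolding norm1_def by (intro tendsto_intros comp)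
  moreover have "norm1 (Pi_seq n \<omega> 1) = 1" for n
    using h[of n] norm1_normalize1 by (simp add: Pi_seq_eq heavy_def)
  ultimately show "norm1 (limit_vector \<omega>) = 1" by (simp add: LIMSEQ_const_iff)
qed

text \<open>
  Normalization turns the share of the norm into a lower bound for the entry, uniform in \<open>n\<close>.
\<close>

lemma limit_vector_pos_of_heavy:
  assumes "C > 0" "\<And>n. n \<ge> N \<Longrightarrow> heavy C j (act (seg \<omega> 0 n) 1)"
  shows "limit_vector \<omega> $ j > 0"
proof -
  have "(\<lambda>n. Pi_seq n \<omega> 1 $ j) \<longlonglongrightarrow> limit_vector \<omega> $ j"
    by (intro tendsto_intros Pi_seq_tendsto_limit_vector)
  moreover have "1 / C \<le> Pi_seq n \<omega> 1 $ j" if "n \<ge> N" for n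
    using assms(1) assms(2)[OF that]
    by (simp add: Pi_seq_eq normalize1_def heavy_def field_simps)
  ultimately have "1 / C \<le> limit_vector \<omega> $ j" by (intro LIMSEQ_le_const) auto
  then show ?thesis using assms(1) by (smt (verit) divide_pos_pos)
qed

lemma heavy_act_replicate:
  assumes "heavy C j z" "C > 0" "\<And>x. (A a *v x) $ j = x $ j"
  shows "heavy (C * 3 ^ k) j (act (replicate k a) z)"
proof -
  have comp: "act (replicate k a) z $ j = z $ j" by (induction k) (simp_all add: assms(3))
  have "0 < act (replicate k a) z $ j" using heavy_pos[OF assms(1,2)] comp by simp
  then have "0 < norm1 (act (replicate k a) z)"
    using component_le_norm1[of "act (replicate k a) z" j] by simp
  moreover have "norm1 (act (replicate k a) z) \<le> 3 ^ k * (C * z $ j)"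
    using norm1_act_le[of "replicate k a" z] assms(1)
    by (smt (verit) heavy_def length_replicate mult_left_mono zero_le_power)
  ultimately show ?thesis
    using assms(1) act_nonneg[of z] comp by (simp add: heavy_def mult_ac)
qed

text \<open>
  After the initial run of \<open>a\<close> comes a letter that makes entry \<open>j\<close> large.  The run keeps this entry and
  multiplies the norm by at most \<open>3\<^sup>k\<close>, with \<open>k\<close> its length, so the share of the entry stays
  bounded below.
\<close>

lemma limit_vector_pos:
  assumes "\<omega> \<noteq> (\<lambda>_. a)" and fixed: "\<And>x. (A a *v x) $ j = x $ j"
    and step: "\<And>b y. b \<noteq> a \<Longrightarrow> y \<in> orbit 1 \<Longrightarrow> heavy (720 * 1\<^sup>2) j (A b *v y)"
  shows "limit_vector \<omega> $ j > 0"
proof -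
  define k where "k = (LEAST k. \<omega> k \<noteq> a)"
  have k: "\<omega> k \<noteq> a" unfolding k_def using assms(1) by (metis (mono_tags, lifting) LeastI ext)
  have "\<omega> r = a" if "r < k" for r
    using not_less_Least[of r "\<lambda>k. \<omega> k \<noteq> a"] that by (auto simp: k_def)
  then have prefix: "seg \<omega> 0 k = replicate k a" using seg_const[of 0 k \<omega> a] by simp
  have "heavy (720 * 3 ^ k) j (act (seg \<omega> 0 n) 1)" if "n \<ge> Suc k" for n
  proof -
    have seg: "seg \<omega> 0 n = replicate k a @ \<omega> k # seg \<omega> (Suc k) n"
      using seg_append[of 0 k n \<omega>] seg_Cons[of k n \<omega>] that by (simp add: prefix)
    have "heavy 720 j (A (\<omega> k) *v act (seg \<omega> (Suc k) n) 1)"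
      using step[OF k act_orbit[OF one_in_orbit[of 1]]] by simp
    from heavy_act_replicate[OF this _ fixed] show ?thesis by (simp add: seg)
  qed
  then show ?thesis by (intro limit_vector_pos_of_heavy[of "720 * 3 ^ k" "Suc k"]) auto
qed

lemma Delta_nth: "\<Delta> W $ i = (if W $ i = 0 then 0 else 1)"
  by (simp add: \<Delta>_def U_def axis_def if_distrib cong: if_cong)

lemma limit_vector_eqI:
  assumes "\<exists>D. \<forall>n>0. \<forall>x\<in>orbit 1. norm1 (normalize1 (act (seg \<omega> 0 n) x) - L) \<le> D / real n"
  shows "limit_vector \<omega> = L"
proof -
  obtain D where D: "\<forall>n>0. \<forall>x\<in>orbit 1. norm1 (normalize1 (act (seg \<omega> 0 n) x) - L) \<le> D / real n"
    using assms by blast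
  have "(\<lambda>n. Pi_seq n \<omega> 1 - L) \<longlonglongrightarrow> 0"
  proof (rule Lim_null_comparison)
    show "\<forall>\<^sub>F n in sequentially. norm (Pi_seq n \<omega> 1 - L) \<le> D / real n"
      using eventually_gt_at_top[of 0]
    proof eventually_elim
      case (elim n)
      then have "norm1 (Pi_seq n \<omega> 1 - L) \<le> D / real n"
        using D one_in_orbit[of 1] by (simp add: Pi_seq_eq)
      then show ?case using norm_le_norm1 order_trans by blast
    qed
    show "(\<lambda>n. D / real n) \<longlonglongrightarrow> 0" by (rule lim_const_over_n)
  qed
  then have "(\<lambda>n. Pi_seq n \<omega> 1) \<longlonglongrightarrow> L" by (simp add: LIM_zero_iff)
  then show ?thesis using Pi_seq_tendsto_limit_vector LIMSEQ_unique by blast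
qed

lemma limit_vector_0: "limit_vector (\<lambda>_. 0) = (1/5) *\<^sub>R (U 2 + U 3 + U 5 + U 6 + U 7)"
proof -
  have "limit_vector (\<lambda>_. 0) = normalize1 growth0"
    using eventually_0_rate[of 1 0 "\<lambda>_. 0"] by (intro limit_vector_eqI) (simp add: seg_def)
  also have "\<dots> = (1/5) *\<^sub>R (U 2 + U 3 + U 5 + U 6 + U 7)"
    unfolding normalize1_def norm1_growth by (simp add: growth0_def)
  finally show ?thesis .
qed

lemma limit_vector_2: "limit_vector (\<lambda>_. 2) = (1/3) *\<^sub>R (U 1 + U 3 + U 4)"
proof -
  have "limit_vector (\<lambda>_. 2) = normalize1 growth2"
    using eventually_2_rate[of 1 0 "\<lambda>_. 2"] by (intro limit_vector_eqI) (simp add: seg_def)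
  also have "\<dots> = (1/3) *\<^sub>R (U 1 + U 3 + U 4)"
    unfolding normalize1_def norm1_growth by (simp add: growth2_def)
  finally show ?thesis .
qed

lemma Delta_limit_vector:
  assumes "\<omega> \<notin> {\<lambda>_. 0, \<lambda>_. 2}"
  shows "\<Delta> (limit_vector \<omega>) \<ge> U 1 + U 3 + U 5"
proof -
  have "limit_vector \<omega> $ 1 > 0"
    using assms heavy_orbit(2)[of 1] by (intro limit_vector_pos[of \<omega> 0]) (simp_all add: A_mult_0)
  moreover have "limit_vector \<omega> $ 3 > 0" by (rule limit_vector_pos_of_heavy[OF _ heavy_act_ones]) simp
  moreover have "limit_vector \<omega> $ 5 > 0"
    using assms heavy_orbit(3)[of 1] by (intro limit_vector_pos[of \<omega> 2]) (simp_all add: A_mult_2)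
  ultimately show ?thesis
    by (simp add: less_eq_vec_def all_7 Delta_nth) (simp add: U_def axis_def)
qed

theorem theorem8p7:
  shows "\<exists>Vlim :: (nat \<Rightarrow> 3) \<Rightarrow> real^7.
    (\<forall>V :: real^7. (\<forall>i. V $ i > 0) \<longrightarrow>
        uniform_limit UNIV (\<lambda>n \<omega>. Pi_seq n \<omega> V) Vlim sequentially) \<and>
    (\<forall>\<omega>. probability_vector (Vlim \<omega>)) \<and>
    (\<forall>\<omega>. \<omega> \<notin> {\<lambda>_. 0, \<lambda>_. 2} \<longrightarrow> \<Delta> (Vlim \<omega>) \<ge> U 1 + U 3 + U 5) \<and>
    Vlim (\<lambda>_. 0) = (1/5) *\<^sub>R (U 2 + U 3 + U 5 + U 6 + U 7) \<and>
    Vlim (\<lambda>_. 2) = (1/3) *\<^sub>R (U 1 + U 3 + U 4)"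
  using Pi_seq_uniform_limit probability_vector_limit_vector Delta_limit_vector limit_vector_0 limit_vector_2
  by (intro exI[of _ limit_vector]) blast

end
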